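(* Let $\alpha=(\alpha_1,\alpha_2),\beta=(\beta_1,\beta_2)\in\mathbb{R}^2$ satisfy $(0,0)\succ\alpha\succeq\beta$, and let $h:\mathbb{U}^2\to\mathbb{C}$ be holomorphic. Then $h\in\mathcal{M}(D_\alpha,D_\beta)$ if and only if there is a constant $C<\infty$ such that \[|h(z,w)|\leq C\,(1-|z|^2)^{\frac{\beta_1-\alpha_1}{2}}(1-|w|^2)^{\frac{\beta_2-\alpha_2}{2}}\quad\text{for all }(z,w)\in\mathbb{U}^2.\]
   Context: $\mathbb{U}$ is the open unit disc in $\mathbb{C}$, $\mathbb{U}^2=\mathbb{U}\times\mathbb{U}$, and $\mathbb{Z}_+$ is the set of nonnegative integers. For $\alpha=(\alpha_1,\alpha_2)\in\mathbb{R}^2$, $D_\alpha$ is the space of functions $f(z,w)=\sum_{(k,l)\in\mathbb{Z}_+^2}a_{k,l}z^kw^l$ on $\mathbb{U}^2$ with $\sum_{(k,l)}|a_{k,l}|^2(k+1)^{\alpha_1}(l+1)^{\alpha_2}<\infty$. $\mathcal{M}(D_\alpha,D_\beta)$ is the set of functions $\phi:\mathbb{U}^2\to\mathbb{C}$ such that $\phi f\in D_\beta$ for all $f\in D_\alpha$. For $\alpha,\beta\in\mathbb{R}^2$: $\alpha\succ\beta$ means $\alpha_1>\beta_1$ and $\alpha_2>\beta_2$; $\alpha\succeq\beta$ means $\alpha_1\ge\beta_1$ and $\alpha_2\ge\beta_2$. *)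

theory Defs
  imports "HOL-Analysis.Analysis"
begin

definition bidisc :: "(complex \<times> complex) set" where
  "bidisc = ball 0 1 \<times> ball 0 1"

text \<open>Holomorphy in two variables is complex Frechet differentiability: the derivative at each
  point is a \<open>\<complex>\<close>-linear map \<open>\<complex>\<^sup>2 \<rightarrow> \<complex>\<close>. It is meant for open \<open>S\<close>.\<close>

definition holomorphic2_on :: "(complex \<times> complex \<Rightarrow> complex) \<Rightarrow> (complex \<times> complex) set \<Rightarrow> bool"
    (infixl \<open>holomorphic2'_on\<close> 50) where
  "f holomorphic2_on S \<longleftrightarrow>
     (\<forall>p\<in>S. \<exists>a b. (f has_derivative (\<lambda>(u, v). a * u + b * v)) (at p within S))"

text \<open>Functions on the bidisc are represented by total functions of which only the values on
  \<open>bidisc\<close> matter. The double power series converges unconditionally (equivalently, absolutely),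
  which the weighted square-summability of the coefficients already guarantees.\<close>

definition D_space :: "real \<times> real \<Rightarrow> (complex \<times> complex \<Rightarrow> complex) set" where
  "D_space \<alpha> =
     {f. \<exists>a :: nat \<times> nat \<Rightarrow> complex.
        (\<lambda>(k, l). (cmod (a (k, l)))\<^sup>2 * (real k + 1) powr fst \<alpha> * (real l + 1) powr snd \<alpha>)
          summable_on UNIV \<and>
        (\<forall>(z, w)\<in>bidisc. ((\<lambda>(k, l). a (k, l) * z ^ k * w ^ l) has_sum f (z, w)) UNIV)}"

definition multipliers ::
    "(complex \<times> complex \<Rightarrow> complex) set \<Rightarrow> (complex \<times> complex \<Rightarrow> complex) set
      \<Rightarrow> (complex \<times> complex \<Rightarrow> complex) set" where
  "multipliers X Y = {\<phi>. \<forall>f\<in>X. (\<lambda>p. \<phi> p * f p) \<in> Y}"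

text \<open>The strict relation requires both coordinates to be strictly larger, so it is not the strict
  part of the weak one.\<close>

definition pair_succ :: "real \<times> real \<Rightarrow> real \<times> real \<Rightarrow> bool" (infix \<open>\<succ>\<close> 50) where
  "\<alpha> \<succ> \<beta> \<longleftrightarrow> fst \<alpha> > fst \<beta> \<and> snd \<alpha> > snd \<beta>"

definition pair_succeq :: "real \<times> real \<Rightarrow> real \<times> real \<Rightarrow> bool" (infix \<open>\<succeq>\<close> 50) where
  "\<alpha> \<succeq> \<beta> \<longleftrightarrow> fst \<alpha> \<ge> fst \<beta> \<and> snd \<alpha> \<ge> snd \<beta>"

end

theory Submission
  imports Defs "HOL-Complex_Analysis.Complex_Analysis" "HOL-Library.Real_Mod"
begin

text \<open>
  Write \<open>\<alpha> = (-s, -t)\<close> and \<open>\<beta> = (-s', -t')\<close> with positive \<open>s\<close>, \<open>t\<close>, \<open>s'\<close>, \<open>t'\<close>. These spaces are weighted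
  Bergman spaces. The weight \<open>(k + 1)\<^sup>-\<^sup>s\<close> is comparable to the Beta value
  \<open>B(k + 1, s) = \<integral>\<^sub>0\<^sup>1 x\<^sup>k (1 - x)\<^sup>s\<^sup>-\<^sup>1 dx\<close>, and with this choice of weight two things are exact: the squared
  norm of \<open>f\<close> is obtained by integrating the mean of \<open>|f|\<^sup>2\<close> over the tori \<open>|z|\<^sup>2 = x\<close>, \<open>|w|\<^sup>2 = y\<close> against the density
  \<open>(1 - x)\<^sup>s\<^sup>-\<^sup>1 (1 - y)\<^sup>t\<^sup>-\<^sup>1\<close>, and the evaluation at \<open>(z, w)\<close> has squared norm
  \<open>s t (1 - |z|\<^sup>2)\<^sup>-\<^sup>s\<^sup>-\<^sup>1 (1 - |w|\<^sup>2)\<^sup>-\<^sup>t\<^sup>-\<^sup>1\<close>.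

  The growth condition is sufficient because its square is exactly the quotient of the densities of the
  two spaces: on each torus the mean of \<open>|h f|\<^sup>2\<close> is at most \<open>C\<^sup>2 (1 - x)\<^sup>s\<^sup>-\<^sup>s\<^sup>' (1 - y)\<^sup>t\<^sup>-\<^sup>t\<^sup>'\<close> times the mean of \<open>|f|\<^sup>2\<close>, and
  integration against the density of the target gives the norm bound
  (\<open>summable_on_beta_weights_if_radial_bound\<close>). Two facts connect means with coefficients: \<open>h f\<close> is
  given by a double power series (\<open>separately_holomorphic_power_series\<close>), and Parseval's formula
  holds on the torus (\<open>torus_Parseval\<close>).

  The growth condition is necessary because, apart from a constant, it is the quotient of the norms of
  the evaluations on the two spaces. If multiplication by \<open>h\<close> were known to be bounded, applying it to
  the kernel function of a point would give the estimate at once. Boundedness follows from the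
  closed graph theorem; the proof here obtains the contradiction directly by a gliding hump. Along a sequence
  of points that violates the estimate, one function \<open>f\<close> is built that is large at all of them
  (\<open>l2_vector_large_against_sequence\<close>), so that \<open>h f\<close> grows too fast for the target space.
\<close>

section \<open>Weights given by the Beta function\<close>

text \<open>This is the Beta value \<open>B(k + 1, s) = \<integral>\<^sub>0\<^sup>1 x\<^sup>k (1 - x)\<^sup>s\<^sup>-\<^sup>1 dx\<close>. It is comparable to
  \<open>(k + 1)\<^sup>-\<^sup>s\<close>, so it defines the same space, and it is the better representative of that size:
  it is exactly a radial moment, and the reciprocals have a generating function in closed form.\<close>

definition beta_weight :: "real \<Rightarrow> nat \<Rightarrow> real" where
  "beta_weight s k = fact k / pochhammer s (Suc k)"

lemma beta_weight_pos: "0 < s \<Longrightarrow> 0 < beta_weight s k"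
  by (simp add: beta_weight_def pochhammer_pos)

text \<open>Up to replacing \<open>k\<close> by \<open>k + 1\<close> in the power, this is Euler's limit formula for the Gamma
  function.\<close>

lemma beta_weight_tendsto:
  assumes "0 < s"
  shows "(\<lambda>k. beta_weight s k * (real k + 1) powr s) \<longlonglongrightarrow> Gamma s"
proof -
  have "(\<lambda>k. Gamma_series s k * ((real k + 1) / real k) powr s) \<longlonglongrightarrow> Gamma s * 1 powr s"
  proof (intro tendsto_mult Gamma_series_LIMSEQ tendsto_powr tendsto_const)
    show "(\<lambda>k. (real k + 1) / real k) \<longlonglongrightarrow> 1" by real_asymp
  qed auto
  moreover have "\<forall>\<^sub>F k in sequentially. Gamma_series s k * ((real k + 1) / real k) powr s
      = beta_weight s k * (real k + 1) powr s"
    using eventually_gt_at_top[of 0]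
  proof eventually_elim
    case (elim k)
    then have "real k powr s * ((real k + 1) / real k) powr s = (real k + 1) powr s"
      by (simp flip: powr_mult)
    moreover have "Gamma_series s k = beta_weight s k * real k powr s"
      using elim by (simp add: Gamma_series_def beta_weight_def powr_def)
    ultimately show ?case by (simp add: mult.assoc)
  qed
  ultimately show ?thesis
    by (simp add: filterlim_cong)
qed

text \<open>The quotient of \<open>beta_weight s k\<close> by \<open>(k + 1)\<^sup>-\<^sup>s\<close> is positive and has a positive limit, so it is bounded and
  bounded away from zero.\<close>

lemma beta_weight_comparable:
  assumes s: "0 < s"
  obtains c C where "0 < c" "0 < C"
    "\<And>k. c * (real k + 1) powr (-s) \<le> beta_weight s k"
    "\<And>k. beta_weight s k \<le> C * (real k + 1) powr (-s)"
proof -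
  let ?u = "\<lambda>k. beta_weight s k * (real k + 1) powr s"
  have lim: "?u \<longlonglongrightarrow> Gamma s" by (rule beta_weight_tendsto[OF s])
  have "Bseq ?u" using lim by (rule convergentI[THEN convergent_imp_Bseq])
  then obtain C where C: "C > 0" "\<And>k. norm (?u k) \<le> C" by (auto elim: BseqE)
  have "Gamma s \<noteq> 0" using s by (auto simp: Gamma_eq_zero_iff)
  then have "(\<lambda>k. inverse (?u k)) \<longlonglongrightarrow> inverse (Gamma s)"
    by (intro tendsto_inverse lim)
  then have "Bseq (\<lambda>k. inverse (?u k))" by (rule convergentI[THEN convergent_imp_Bseq])
  then obtain D where D: "D > 0" "\<And>k. norm (inverse (?u k)) \<le> D" by (auto elim: BseqE)
  have pos: "0 < (real k + 1) powr s" for k by simp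
  show ?thesis
  proof (rule that[of "inverse D" C])
    fix k
    have "inverse (?u k) \<le> D" using D(2)[of k] by (simp add: abs_if split: if_splits)
    then have "inverse D \<le> ?u k"
      using D(1) beta_weight_pos[OF s, of k] pos[of k] by (simp add: field_simps)
    then have "inverse D / (real k + 1) powr s \<le> beta_weight s k"
      using pos[of k] by (simp only: pos_divide_le_eq)
    then show "inverse D * (real k + 1) powr (-s) \<le> beta_weight s k"
      by (simp add: powr_minus divide_inverse)
    have "?u k \<le> C" using C(2)[of k] by simp
    then show "beta_weight s k \<le> C * (real k + 1) powr (-s)"
      using pos[of k] by (simp add: powr_minus field_simps)
  qed (use C D in auto)
qed

text \<open>Up to the factor \<open>s\<close>, the Taylor series of \<open>(1 - x)\<^sup>-\<^sup>s\<^sup>-\<^sup>1\<close>. In one variable this is the reproducing kernel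
  on the diagonal, with \<open>x = |z|\<^sup>2\<close>.\<close>

lemma sums_inverse_beta_weight:
  assumes s: "0 < s" and x: "0 \<le> x" "x < 1"
  shows "(\<lambda>k. x ^ k / beta_weight s k) sums (s * (1 - x) powr (-s - 1))"
proof -
  have "(\<lambda>k. ((-s - 1) gchoose k) * (-x) ^ k) sums (1 + (-x)) powr (-s - 1)"
    using x by (intro gen_binomial_real) auto
  then have "(\<lambda>k. s * (((-s - 1) gchoose k) * (-x) ^ k)) sums (s * (1 - x) powr (-s - 1))"
    using sums_mult by fastforce
  moreover have "s * (((-s - 1) gchoose k) * (-x) ^ k) = x ^ k / beta_weight s k" for k
  proof -
    have "((-s - 1) gchoose k) = (- 1) ^ k * pochhammer (s + 1) k / fact k"
      by (simp add: gbinomial_pochhammer add.commute)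
    moreover have "(- 1) ^ k * (- x) ^ k = x ^ k" by (simp flip: power_mult_distrib)
    moreover have "s * p / q * m = m * (s * p) / q" for p q m :: real by simp
    ultimately show ?thesis
      using s by (simp add: beta_weight_def pochhammer_rec mult_ac)
  qed
  ultimately show ?thesis by simp
qed

lemma beta_weight_eq_Beta:
  assumes "0 < s"
  shows "beta_weight s k = Beta (real k + 1) s"
proof -
  have "s \<notin> \<int>\<^sub>\<le>\<^sub>0" using assms by auto
  then have "pochhammer s (Suc k) = Gamma (real k + 1 + s) / Gamma s"
    using pochhammer_Gamma[of s "Suc k"] by (simp add: add_ac)
  moreover have "fact k = Gamma (real k + 1)"
    using Gamma_fact[of k, where ?'a=real] by (simp add: add.commute)
  ultimately show ?thesis by (simp add: beta_weight_def Beta_def)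
qed

lemma nn_integral_beta_weight:
  assumes "0 < s"
  shows "(\<integral>\<^sup>+x. indicator {0..1} x * ennreal (x ^ k * (1 - x) powr (s - 1)) \<partial>lborel)
      = ennreal (beta_weight s k)"
proof -
  have "((\<lambda>t. t powr (real k + 1 - 1) * (1 - t) powr (s - 1)) has_integral beta_weight s k) {0..1}"
    unfolding beta_weight_eq_Beta[OF assms] using assms by (intro has_integral_Beta_real) auto
  then have "((\<lambda>t. t powr real k * (1 - t) powr (s - 1)) has_integral beta_weight s k) {0<..<1}"
    by (simp add: has_integral_Icc_iff_Ioo)
  moreover have "t powr real k = t ^ k" if "t \<in> {0<..<1}" for t :: real
    using that by (simp add: powr_realpow)
  ultimately have "((\<lambda>t. t ^ k * (1 - t) powr (s - 1)) has_integral beta_weight s k) {0<..<1}"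
    by (metis (no_types, lifting) has_integral_cong)
  then have "((\<lambda>t. t ^ k * (1 - t) powr (s - 1)) has_integral beta_weight s k) {0..1}"
    by (simp only: has_integral_Icc_iff_Ioo)
  then have "(\<integral>\<^sup>+x. ennreal (indicator {0..1} x * (x ^ k * (1 - x) powr (s - 1))) \<partial>lborel)
      = ennreal (beta_weight s k)"
    by (intro nn_integral_has_integral_lebesgue) (simp_all add: zero_le_mult_iff)
  moreover have "indicator {0..1} x * ennreal y = ennreal (indicator {0..1} x * y)" for x y :: real
    by (simp split: split_indicator)
  ultimately show ?thesis by (simp only:)
qed

section \<open>Integrating double power series against Beta densities\<close>

lemma has_sum_double_product:
  fixes f g :: "nat \<Rightarrow> real"
  assumes f: "(f has_sum A) UNIV" and g: "(g has_sum B) UNIV"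
    and f0: "\<And>k. 0 \<le> f k" and g0: "\<And>l. 0 \<le> g l"
  shows "((\<lambda>(k, l). f k * g l) has_sum (A * B)) UNIV"
proof -
  have inner: "((\<lambda>l. case (k, l) of (k, l) \<Rightarrow> f k * g l) has_sum f k * B) UNIV" for k
    by (simp only: prod.case has_sum_cmult_right[OF g])
  have outer: "((\<lambda>k. f k * B) has_sum A * B) UNIV" by (rule has_sum_cmult_left[OF f])
  have "(\<lambda>(k, l). f k * g l) summable_on (SIGMA k:UNIV. UNIV)"
    by (rule summable_on_SigmaI[OF inner has_sum_imp_summable[OF outer]]) (simp add: f0 g0)
  from has_sum_SigmaI[OF inner outer this] show ?thesis by simp
qed

text \<open>This lemma and the next pass between unconditional real sums over pairs and iterated
  series of extended nonnegative reals, where monotone convergence applies without side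
  conditions.\<close>

lemma suminf_ennreal_double:
  fixes F :: "nat \<times> nat \<Rightarrow> real"
  assumes F: "F summable_on UNIV" and F0: "\<And>p. 0 \<le> F p"
  shows "(\<Sum>k. \<Sum>l. ennreal (F (k, l))) = ennreal (infsum F UNIV)"
proof -
  have F': "(\<lambda>(k, l). F (k, l)) summable_on UNIV \<times> UNIV" using F by (simp add: case_prod_unfold)
  have in1: "(\<lambda>l. F (k, l)) summable_on UNIV" for k
    using summable_on_SigmaD1[OF F', of k] by simp
  have inner: "(\<Sum>l. ennreal (F (k, l))) = ennreal (\<Sum>\<^sub>\<infinity>l. F (k, l))" for k
    by (rule suminf_ennreal_eq[OF F0 has_sum_imp_sums[OF has_sum_infsum[OF in1]]])
  have out: "(\<lambda>k. \<Sum>\<^sub>\<infinity>l. F (k, l)) summable_on UNIV"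
    by (rule summable_on_Sigma_banach[OF F'])
  have "(\<Sum>k. ennreal (\<Sum>\<^sub>\<infinity>l. F (k, l))) = ennreal (\<Sum>\<^sub>\<infinity>k. \<Sum>\<^sub>\<infinity>l. F (k, l))"
    by (rule suminf_ennreal_eq[OF _ has_sum_imp_sums[OF has_sum_infsum[OF out]]])
       (simp add: infsum_nonneg F0)
  also have "(\<Sum>\<^sub>\<infinity>k. \<Sum>\<^sub>\<infinity>l. F (k, l)) = infsum F UNIV"
    using infsum_Sigma'_banach[OF F'] by (simp add: case_prod_unfold)
  finally show ?thesis by (simp only: inner)
qed

lemma summable_on_if_suminf_ennreal_double:
  fixes F :: "nat \<times> nat \<Rightarrow> real"
  assumes fin: "(\<Sum>k. \<Sum>l. ennreal (F (k, l))) \<noteq> top" and F0: "\<And>p. 0 \<le> F p"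
  shows "F summable_on UNIV"
proof -
  have fin_in: "(\<Sum>l. ennreal (F (k, l))) \<noteq> top" for k
    using ennreal_suminf_lessD[of "\<lambda>k. \<Sum>l. ennreal (F (k, l))" top k] fin by (simp add: top.not_eq_extremum)
  have sm: "summable (\<lambda>l. F (k, l))" for k
    by (rule summable_suminf_not_top[OF F0 fin_in])
  have in0: "0 \<le> (\<Sum>l. F (k, l))" for k by (rule suminf_nonneg[OF sm F0])
  have "(\<Sum>k. ennreal (\<Sum>l. F (k, l))) \<noteq> top"
    using fin unfolding suminf_ennreal2[OF F0 sm] .
  then have "summable (\<lambda>k. \<Sum>l. F (k, l))" by (rule summable_suminf_not_top[OF in0])
  then have out: "(\<lambda>k. \<Sum>l. F (k, l)) summable_on UNIV"
    by (rule summable_nonneg_imp_summable_on) (rule in0)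
  have "F summable_on (SIGMA k:UNIV. UNIV)"
    by (rule summable_on_SigmaI[OF sums_nonneg_imp_has_sum[OF summable_sums[OF sm]] out])
       (simp_all add: F0)
  then show ?thesis by simp
qed

lemma nn_integral_double_series:
  fixes e :: "nat \<Rightarrow> nat \<Rightarrow> ennreal"
  assumes "0 < s" "0 < t"
  shows "(\<integral>\<^sup>+x. \<integral>\<^sup>+y. (\<Sum>k. \<Sum>l. e k l * (indicator {0..1} x * ennreal (x ^ k * (1 - x) powr (s - 1)))
            * (indicator {0..1} y * ennreal (y ^ l * (1 - y) powr (t - 1)))) \<partial>lborel \<partial>lborel)
    = (\<Sum>k. \<Sum>l. e k l * ennreal (beta_weight s k) * ennreal (beta_weight t l))"
proof -
  define p :: "real \<Rightarrow> nat \<Rightarrow> real \<Rightarrow> ennreal"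
    where "p s k x = indicator {0..1} x * ennreal (x ^ k * (1 - x) powr (s - 1))" for s k x
  have [measurable]: "p s k \<in> borel_measurable lborel" for s k
    unfolding p_def by measurable
  have int_p: "(\<integral>\<^sup>+x. p s k x \<partial>lborel) = ennreal (beta_weight s k)" if "0 < s" for s k
    unfolding p_def by (rule nn_integral_beta_weight[OF that])
  have "(\<integral>\<^sup>+x. \<integral>\<^sup>+y. (\<Sum>k. \<Sum>l. e k l * p s k x * p t l y) \<partial>lborel \<partial>lborel)
      = (\<integral>\<^sup>+x. (\<Sum>k. \<Sum>l. e k l * p s k x * ennreal (beta_weight t l)) \<partial>lborel)"
    by (simp add: nn_integral_suminf nn_integral_cmult int_p[OF assms(2)])
  also have "\<dots> = (\<Sum>k. \<Sum>l. e k l * ennreal (beta_weight s k) * ennreal (beta_weight t l))"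
    by (simp add: nn_integral_suminf nn_integral_cmult nn_integral_multc int_p[OF assms(1)])
  finally show ?thesis unfolding p_def .
qed

text \<open>Multiplying the assumed inequality by \<open>(1 - x)\<^sup>s\<^sup>'\<^sup>-\<^sup>1 (1 - y)\<^sup>t\<^sup>'\<^sup>-\<^sup>1\<close> turns the right-hand factor into
  \<open>(1 - x)\<^sup>s\<^sup>-\<^sup>1 (1 - y)\<^sup>t\<^sup>-\<^sup>1\<close>. Integrating over the unit square replaces every monomial by its
  weight, and the bound on the tori becomes a bound on the weighted sums of coefficients.\<close>

lemma summable_on_beta_weights_if_radial_bound:
  fixes A B :: "nat \<times> nat \<Rightarrow> real"
  assumes s: "0 < s" "0 < s'" and t: "0 < t" "0 < t'"
    and A0: "\<And>p. 0 \<le> A p" and B0: "\<And>p. 0 \<le> B p" and D: "0 \<le> D"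
    and A: "(\<lambda>(k, l). A (k, l) * (beta_weight s k * beta_weight t l)) summable_on UNIV"
    and A': "\<And>x y. 0 \<le> x \<Longrightarrow> x < 1 \<Longrightarrow> 0 \<le> y \<Longrightarrow> y < 1 \<Longrightarrow> (\<lambda>(k, l). A (k, l) * x ^ k * y ^ l) summable_on UNIV"
    and B': "\<And>x y. 0 \<le> x \<Longrightarrow> x < 1 \<Longrightarrow> 0 \<le> y \<Longrightarrow> y < 1 \<Longrightarrow> (\<lambda>(k, l). B (k, l) * x ^ k * y ^ l) summable_on UNIV"
    and le: "\<And>x y. 0 \<le> x \<Longrightarrow> x < 1 \<Longrightarrow> 0 \<le> y \<Longrightarrow> y < 1 \<Longrightarrow>
      (\<Sum>\<^sub>\<infinity>(k, l). B (k, l) * x ^ k * y ^ l) \<le>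
      D * (1 - x) powr (s - s') * (1 - y) powr (t - t') * (\<Sum>\<^sub>\<infinity>(k, l). A (k, l) * x ^ k * y ^ l)"
  shows "(\<lambda>(k, l). B (k, l) * (beta_weight s' k * beta_weight t' l)) summable_on UNIV"
proof -
  define I where "I E s t x y = (\<Sum>k. \<Sum>l. ennreal (E (k, l)) * (indicator {0..1} x * ennreal (x ^ k * (1 - x) powr (s - 1)))
            * (indicator {0..1} y * ennreal (y ^ l * (1 - y) powr (t - 1))))"
    for E :: "nat \<times> nat \<Rightarrow> real" and s t x y :: real
  have int_I: "(\<integral>\<^sup>+x. \<integral>\<^sup>+y. I E s t x y \<partial>lborel \<partial>lborel)
      = (\<Sum>k. \<Sum>l. ennreal ((\<lambda>(k, l). E (k, l) * (beta_weight s k * beta_weight t l)) (k, l)))"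
    if "0 < s" "0 < t" "\<And>p. 0 \<le> E p" for E s t
    unfolding I_def nn_integral_double_series[OF that(1,2)]
    by (simp add: ennreal_mult' ennreal_mult'' that less_imp_le[OF beta_weight_pos] mult.assoc)
  have I_in: "I E s t x y = ennreal ((1 - x) powr (s - 1) * (1 - y) powr (t - 1) * (\<Sum>\<^sub>\<infinity>(k, l). E (k, l) * x ^ k * y ^ l))"
    if xy: "0 \<le> x" "x < 1" "0 \<le> y" "y < 1" and E0: "\<And>p. 0 \<le> E p"
      and E: "(\<lambda>(k, l). E (k, l) * x ^ k * y ^ l) summable_on UNIV" for E s t x y
  proof -
    let ?c = "(1 - x) powr (s - 1) * (1 - y) powr (t - 1)"
    let ?F = "\<lambda>p. ?c * (case p of (k, l) \<Rightarrow> E (k, l) * x ^ k * y ^ l)"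
    have nn: "0 \<le> ?F p" for p using xy E0 by (simp add: case_prod_unfold)
    have "I E s t x y = (\<Sum>k. \<Sum>l. ennreal (?F (k, l)))"
    proof -
      have "ennreal (E (k, l)) * (indicator {0..1} x * ennreal (x ^ k * (1 - x) powr (s - 1)))
            * (indicator {0..1} y * ennreal (y ^ l * (1 - y) powr (t - 1))) = ennreal (?F (k, l))" for k l
        using xy E0[of "(k, l)"] by (simp add: ennreal_mult'[symmetric] mult_ac)
      then show ?thesis by (simp only: I_def)
    qed
    also have "\<dots> = ennreal (infsum ?F UNIV)"
      by (rule suminf_ennreal_double[OF summable_on_cmult_right[OF E] nn])
    also have "infsum ?F UNIV = ?c * (\<Sum>\<^sub>\<infinity>(k, l). E (k, l) * x ^ k * y ^ l)"
      by (rule infsum_cmult_right[OF E])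
    finally show ?thesis .
  qed
  \<comment> \<open>At \<open>x = 1\<close> or \<open>y = 1\<close> the density vanishes because \<open>0 powr a = 0\<close>, whatever the sign of \<open>a\<close>.\<close>
  have I_out: "I E s t x y = 0" if "\<not> (0 \<le> x \<and> x < 1 \<and> 0 \<le> y \<and> y < 1)" for E s t x y
  proof -
    have "(indicator {0..1} x :: ennreal) * ennreal (x ^ k * (1 - x) powr (s - 1)) = 0
      \<or> (indicator {0..1} y :: ennreal) * ennreal (y ^ l * (1 - y) powr (t - 1)) = 0" for k l
      using that by (cases "x = 1"; cases "y = 1") (auto simp: indicator_def)
    then have "ennreal (E (k, l)) * (indicator {0..1} x * ennreal (x ^ k * (1 - x) powr (s - 1)))
            * (indicator {0..1} y * ennreal (y ^ l * (1 - y) powr (t - 1))) = 0" for k l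
      by (metis mult_zero_left mult_zero_right)
    then show ?thesis by (simp only: I_def suminf_zero)
  qed
  have I_le: "I B s' t' x y \<le> ennreal D * I A s t x y" for x y
  proof (cases "0 \<le> x \<and> x < 1 \<and> 0 \<le> y \<and> y < 1")
    case True
    then have xy: "0 \<le> x" "x < 1" "0 \<le> y" "y < 1" by auto
    let ?a = "\<Sum>\<^sub>\<infinity>(k, l). A (k, l) * x ^ k * y ^ l"
    have "(1 - x) powr (s' - 1) * (1 - y) powr (t' - 1) * (\<Sum>\<^sub>\<infinity>(k, l). B (k, l) * x ^ k * y ^ l)
       \<le> (1 - x) powr (s' - 1) * (1 - y) powr (t' - 1) * (D * (1 - x) powr (s - s') * (1 - y) powr (t - t') * ?a)"
      by (intro mult_left_mono le xy) auto
    also have "\<dots> = D * (((1 - x) powr (s' - 1) * (1 - x) powr (s - s')) * ((1 - y) powr (t' - 1) * (1 - y) powr (t - t')) * ?a)"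
      by (simp only: mult_ac)
    also have "\<dots> = D * ((1 - x) powr (s - 1) * (1 - y) powr (t - 1) * ?a)"
      by (simp flip: powr_add)
    finally show ?thesis
      using D by (simp add: I_in[OF xy B0 B'[OF xy]] I_in[OF xy A0 A'[OF xy]] ennreal_mult'[symmetric] ennreal_leI)
  qed (simp add: I_out)
  have "(\<Sum>k. \<Sum>l. ennreal ((\<lambda>(k, l). B (k, l) * (beta_weight s' k * beta_weight t' l)) (k, l)))
      = (\<integral>\<^sup>+x. \<integral>\<^sup>+y. I B s' t' x y \<partial>lborel \<partial>lborel)"
    using int_I[OF s(2) t(2) B0] by simp
  also have "\<dots> \<le> (\<integral>\<^sup>+x. \<integral>\<^sup>+y. ennreal D * I A s t x y \<partial>lborel \<partial>lborel)"
    by (intro nn_integral_mono I_le)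
  also have "\<dots> = ennreal D * (\<integral>\<^sup>+x. \<integral>\<^sup>+y. I A s t x y \<partial>lborel \<partial>lborel)"
    by (simp add: nn_integral_cmult I_def)
  also have "\<dots> = ennreal D * ennreal (\<Sum>\<^sub>\<infinity>(k, l). A (k, l) * (beta_weight s k * beta_weight t l))"
    unfolding int_I[OF s(1) t(1) A0]
    by (subst suminf_ennreal_double[OF A])
       (auto simp: A0 less_imp_le[OF beta_weight_pos] s t)
  also have "\<dots> < top" by (simp add: ennreal_mult_less_top)
  finally show ?thesis
    by (intro summable_on_if_suminf_ennreal_double)
       (auto simp: B0 less_imp_le[OF beta_weight_pos] s t)
qed

section \<open>A uniform boundedness principle in a sequence space\<close>

text \<open>The inequality for finite sums bounds all partial sums, and these determine an unconditional sum
  of nonnegative terms.\<close>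

lemma l2_Cauchy_Schwarz:
  fixes u v :: "'i \<Rightarrow> complex"
  assumes u: "(\<lambda>i. (cmod (u i))\<^sup>2) summable_on UNIV" and v: "(\<lambda>i. (cmod (v i))\<^sup>2) summable_on UNIV"
  shows "(\<lambda>i. cmod (u i * v i)) summable_on UNIV"
    and "(\<Sum>\<^sub>\<infinity>i. cmod (u i * v i)) \<le> sqrt (\<Sum>\<^sub>\<infinity>i. (cmod (u i))\<^sup>2) * sqrt (\<Sum>\<^sub>\<infinity>i. (cmod (v i))\<^sup>2)"
proof -
  show 1: "(\<lambda>i. cmod (u i * v i)) summable_on UNIV"
    by (rule abs_summable_product) (use u v in \<open>simp_all add: norm_mult power2_eq_square\<close>)
  show "(\<Sum>\<^sub>\<infinity>i. cmod (u i * v i)) \<le> sqrt (\<Sum>\<^sub>\<infinity>i. (cmod (u i))\<^sup>2) * sqrt (\<Sum>\<^sub>\<infinity>i. (cmod (v i))\<^sup>2)"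
  proof (rule infsum_le_finite_sums[OF 1])
    fix F :: "'i set" assume F: "finite F"
    have "(\<Sum>i\<in>F. cmod (u i * v i)) \<le> L2_set (\<lambda>i. cmod (u i)) F * L2_set (\<lambda>i. cmod (v i)) F"
      using L2_set_mult_ineq[of "\<lambda>i. cmod (u i)" "\<lambda>i. cmod (v i)" F] by (simp add: norm_mult)
    also have "\<dots> \<le> sqrt (\<Sum>\<^sub>\<infinity>i. (cmod (u i))\<^sup>2) * sqrt (\<Sum>\<^sub>\<infinity>i. (cmod (v i))\<^sup>2)"
    proof (rule mult_mono)
      have "(\<Sum>i\<in>F. (cmod (w i))\<^sup>2) \<le> (\<Sum>\<^sub>\<infinity>i. (cmod (w i))\<^sup>2)"
        if "(\<lambda>i. (cmod (w i))\<^sup>2) summable_on UNIV" for w :: "'i \<Rightarrow> complex"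
        by (rule finite_sum_le_infsum[OF that F]) simp_all
      from this[OF u] this[OF v]
      show "L2_set (\<lambda>i. cmod (u i)) F \<le> sqrt (\<Sum>\<^sub>\<infinity>i. (cmod (u i))\<^sup>2)"
        and "L2_set (\<lambda>i. cmod (v i)) F \<le> sqrt (\<Sum>\<^sub>\<infinity>i. (cmod (v i))\<^sup>2)"
        by (simp_all add: L2_set_def)
    qed (simp_all add: infsum_nonneg L2_set_nonneg)
    finally show "(\<Sum>i\<in>F. cmod (u i * v i)) \<le> \<dots>" .
  qed
qed

text \<open>The signs are chosen one after the other. If \<open>S\<close> is the part of row \<open>n\<close> that is already
  determined, then \<open>|S + A n n| + |S - A n n| \<ge> 2 |A n n|\<close>, so one of the two signs leaves a sum
  that is at least as large as the diagonal entry.\<close>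

lemma signs_against_cancellation:
  fixes A :: "nat \<Rightarrow> nat \<Rightarrow> complex"
  obtains \<epsilon> :: "nat \<Rightarrow> complex" where "\<And>n. cmod (\<epsilon> n) = 1"
    "\<And>n. cmod (A n n) \<le> cmod (\<Sum>m\<le>n. \<epsilon> m * A n m)"
proof -
  define P where "P f n e \<longleftrightarrow> cmod e = 1 \<and> cmod (A n n) \<le> cmod ((\<Sum>m<n. f m * A n m) + e * A n n)"
    for f :: "nat \<Rightarrow> complex" and n e
  have "\<exists>f :: nat \<Rightarrow> complex. \<forall>n. P f n (f n)"
  proof (rule dependent_wellorder_choice)
    fix r and f g :: "nat \<Rightarrow> complex" and n assume "\<And>m. m < n \<Longrightarrow> f m = g m"
    then have "(\<Sum>m<n. f m * A n m) = (\<Sum>m<n. g m * A n m)" by (intro sum.cong) auto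
    then show "P f n r = P g n r" by (simp add: P_def)
  next
    fix n and f :: "nat \<Rightarrow> complex"
    let ?S = "\<Sum>m<n. f m * A n m"
    have "2 * cmod (A n n) \<le> cmod (?S + 1 * A n n) + cmod (?S + (-1) * A n n)"
      using norm_triangle_ineq4[of "?S + A n n" "?S - A n n"] by (simp add: norm_mult)
    then have "P f n 1 \<or> P f n (-1)" unfolding P_def by auto
    then show "\<exists>r. P f n r" by blast
  qed
  then obtain f where f: "\<And>n. P f n (f n)" by blast
  show ?thesis
  proof (rule that[of f])
    fix n show "cmod (f n) = 1" using f by (simp add: P_def)
    show "cmod (A n n) \<le> cmod (\<Sum>m\<le>n. f m * A n m)"
      using f[of n] by (simp add: P_def flip: lessThan_Suc_atMost)
  qed
qed

text \<open>A quantitative uniform boundedness principle. The vector is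
  \<open>b = \<Sum>\<^sub>m \<plusminus> 3\<^sup>-\<^sup>m u\<^sub>m\<close>, where \<open>u\<^sub>m\<close> is the unit vector on which the functional \<open>g\<^sub>m\<close> attains its norm
  \<open>N m\<close>. Pairing with \<open>g\<^sub>n\<close>, the signs keep the first \<open>n + 1\<close> terms at least \<open>3\<^sup>-\<^sup>n N n\<close> in modulus,
  while the remaining terms add up to at most \<open>N n \<Sum>\<^sub>m\<^sub>>\<^sub>n 3\<^sup>-\<^sup>m = 3\<^sup>-\<^sup>n N n / 2\<close>.\<close>

lemma l2_vector_large_against_sequence:
  fixes g :: "nat \<Rightarrow> 'i \<Rightarrow> complex"
  assumes g: "\<And>n. (\<lambda>i. (cmod (g n i))\<^sup>2) summable_on UNIV"
  obtains b where "(\<lambda>i. (cmod (b i))\<^sup>2) summable_on UNIV"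
    "\<And>n. (1/3) ^ n / 2 * sqrt (\<Sum>\<^sub>\<infinity>i. (cmod (g n i))\<^sup>2) \<le> cmod (\<Sum>\<^sub>\<infinity>i. b i * g n i)"
proof -
  define N where "N n = sqrt (\<Sum>\<^sub>\<infinity>i. (cmod (g n i))\<^sup>2)" for n
  have N0: "0 \<le> N n" for n unfolding N_def by (simp add: infsum_nonneg)
  have N2: "(N n)\<^sup>2 = (\<Sum>\<^sub>\<infinity>i. (cmod (g n i))\<^sup>2)" for n
    unfolding N_def by (simp add: infsum_nonneg)
  \<comment> \<open>If \<open>g n\<close> vanishes, then so does \<open>u n\<close>, because division by 0 gives 0.\<close>
  define u where "u n i = cnj (g n i) / of_real (N n)" for n i
  have u_eq: "(cmod (u n i))\<^sup>2 = (cmod (g n i))\<^sup>2 / (N n)\<^sup>2" for n i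
    by (simp add: u_def norm_divide power_divide)
  have u_sum: "(\<lambda>i. (cmod (u n i))\<^sup>2) summable_on UNIV" for n
    unfolding u_eq using summable_on_cmult_left[OF g[of n], of "inverse ((N n)\<^sup>2)"]
    by (simp add: divide_inverse)
  have u_le: "(\<Sum>\<^sub>\<infinity>i. (cmod (u n i))\<^sup>2) \<le> 1" for n
    unfolding u_eq divide_inverse
    by (subst infsum_cmult_left) (use g in \<open>auto simp flip: N2 divide_inverse\<close>)
  have u_pt: "cmod (u n i) \<le> 1" for n i
  proof -
    have "(cmod (u n i))\<^sup>2 \<le> (\<Sum>\<^sub>\<infinity>i. (cmod (u n i))\<^sup>2)"
      using finite_sum_le_infsum[OF u_sum[of n], of "{i}"] by simp
    then have "(cmod (u n i))\<^sup>2 \<le> 1" using u_le[of n] by linarith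
    then show ?thesis by (simp add: power_le_one_iff abs_square_le_1)
  qed
  define G where "G n m = (\<Sum>\<^sub>\<infinity>i. u m i * g n i)" for n m
  have ug_sum: "(\<lambda>i. cmod (u m i * g n i)) summable_on UNIV" for m n
    by (rule l2_Cauchy_Schwarz(1)[OF u_sum g])
  have ug_le: "(\<Sum>\<^sub>\<infinity>i. cmod (u m i * g n i)) \<le> N n" for m n
  proof -
    have "(\<Sum>\<^sub>\<infinity>i. cmod (u m i * g n i)) \<le> sqrt (\<Sum>\<^sub>\<infinity>i. (cmod (u m i))\<^sup>2) * N n"
      unfolding N_def by (rule l2_Cauchy_Schwarz(2)[OF u_sum g])
    also have "\<dots> \<le> 1 * N n"
      using u_le[of m] N0 by (intro mult_right_mono) auto
    finally show ?thesis by simp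
  qed
  have G_le: "cmod (G n m) \<le> N n" for n m
    unfolding G_def using norm_infsum_bound[OF ug_sum[of m n]] ug_le[of m n] by simp
  have G_diag: "G n n = of_real (N n)" for n
  proof -
    have "G n n = (\<Sum>\<^sub>\<infinity>i. of_real ((cmod (g n i))\<^sup>2 * inverse (N n)))"
      unfolding G_def u_def
      by (rule infsum_cong) (simp add: complex_norm_square[symmetric] divide_inverse mult.assoc[symmetric] mult.commute[of "cnj _"])
    also have "\<dots> = of_real (\<Sum>\<^sub>\<infinity>i. (cmod (g n i))\<^sup>2 * inverse (N n))"
      by (rule infsumI, rule has_sum_of_real, rule has_sum_infsum)
         (use summable_on_cmult_left[OF g[of n]] in auto)
    also have "(\<Sum>\<^sub>\<infinity>i. (cmod (g n i))\<^sup>2 * inverse (N n)) = (N n)\<^sup>2 * inverse (N n)"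
      by (subst infsum_cmult_left) (use g N2 in auto)
    finally show ?thesis by (cases "N n = 0") (simp_all add: power2_eq_square)
  qed
  obtain \<epsilon> :: "nat \<Rightarrow> complex" where \<epsilon>: "\<And>n. cmod (\<epsilon> n) = 1"
    and \<epsilon>_ge: "\<And>n. cmod ((1/3) ^ n * G n n) \<le> cmod (\<Sum>m\<le>n. \<epsilon> m * ((1/3) ^ m * G n m))"
    using signs_against_cancellation[of "\<lambda>n m. (1/3) ^ m * G n m"] by blast
  have geo: "(\<lambda>m. (1/3::real) ^ m) sums (3/2)"
    using geometric_sums[of "1/3::real"] by simp
  have geo': "((\<lambda>m. (1/3::real) ^ m) has_sum (3/2)) UNIV"
    using geo by (intro sums_nonneg_imp_has_sum) auto
  define t where "t m i = \<epsilon> m * (1/3) ^ m * u m i" for m i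
  have t_norm: "cmod (t m i) = (1/3) ^ m * cmod (u m i)" for m i
    by (simp add: t_def norm_mult norm_power \<epsilon> norm_divide)
  define b where "b i = (\<Sum>\<^sub>\<infinity>m. t m i)" for i
  have t_le: "cmod (t m i) \<le> (1/3) ^ m" for m i
    using u_pt[of m i] by (simp add: t_norm mult_left_le)
  have t_sum: "(\<lambda>m. cmod (t m i)) summable_on UNIV" for i
    using geo' t_le by (intro summable_on_comparison_test[OF has_sum_imp_summable[OF geo']]) auto
  \<comment> \<open>Jensen's inequality for the weights \<open>3\<^sup>-\<^sup>m\<close>\<close>
  have b_sq: "(cmod (b i))\<^sup>2 \<le> 3/2 * (\<Sum>\<^sub>\<infinity>m. (1/3) ^ m * (cmod (u m i))\<^sup>2)" for i
  proof -
    let ?p = "\<lambda>m. complex_of_real (sqrt ((1/3) ^ m))" and ?q = "\<lambda>m. complex_of_real (sqrt ((1/3) ^ m) * cmod (u m i))"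
    have p: "(\<lambda>m. (cmod (?p m))\<^sup>2) = (\<lambda>m. (1/3) ^ m)" by (simp add: norm_power)
    have q: "(\<lambda>m. (cmod (?q m))\<^sup>2) = (\<lambda>m. (1/3) ^ m * (cmod (u m i))\<^sup>2)"
      by (simp add: norm_mult power_mult_distrib)
    have qs: "(\<lambda>m. (1/3) ^ m * (cmod (u m i))\<^sup>2) summable_on UNIV"
      by (rule summable_on_comparison_test[OF has_sum_imp_summable[OF geo']])
         (use u_pt[of _ i] in \<open>auto simp: mult_left_le power_le_one\<close>)
    have pq: "(\<lambda>m. cmod (?p m * ?q m)) = (\<lambda>m. cmod (t m i))"
      by (auto simp: norm_mult t_norm fun_eq_iff simp flip: mult.assoc)
    have "cmod (b i) \<le> (\<Sum>\<^sub>\<infinity>m. cmod (t m i))"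
      unfolding b_def by (rule norm_infsum_bound[OF t_sum])
    also have "\<dots> \<le> sqrt (3/2) * sqrt (\<Sum>\<^sub>\<infinity>m. (1/3) ^ m * (cmod (u m i))\<^sup>2)"
      using l2_Cauchy_Schwarz(2)[of ?p ?q] geo' qs
      unfolding p q pq by (simp add: infsumI has_sum_imp_summable)
    finally have "(cmod (b i))\<^sup>2 \<le> (sqrt (3/2) * sqrt (\<Sum>\<^sub>\<infinity>m. (1/3) ^ m * (cmod (u m i))\<^sup>2))\<^sup>2"
      by (intro power_mono) auto
    then show ?thesis by (simp add: power_mult_distrib infsum_nonneg)
  qed
  have double: "(\<lambda>(m, i). (1/3) ^ m * (cmod (u m i))\<^sup>2) summable_on UNIV \<times> UNIV"
  proof (rule summable_on_SigmaI[where g="\<lambda>m. (1/3) ^ m * (\<Sum>\<^sub>\<infinity>i. (cmod (u m i))\<^sup>2)"])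
    show "((\<lambda>i. case (m, i) of (m, i) \<Rightarrow> (1/3) ^ m * (cmod (u m i))\<^sup>2) has_sum
        (1/3) ^ m * (\<Sum>\<^sub>\<infinity>i. (cmod (u m i))\<^sup>2)) UNIV" for m
      using u_sum[of m] by (auto intro!: has_sum_cmult_right)
    show "(\<lambda>m. (1/3) ^ m * (\<Sum>\<^sub>\<infinity>i. (cmod (u m i))\<^sup>2)) summable_on UNIV"
      by (rule summable_on_comparison_test[OF has_sum_imp_summable[OF geo']])
         (use u_le in \<open>auto simp: mult_left_le infsum_nonneg\<close>)
  qed auto
  show ?thesis
  proof (rule that[of b])
    have "(\<lambda>(i, m). (1/3) ^ m * (cmod (u m i))\<^sup>2) summable_on UNIV \<times> UNIV"
      using double by (subst summable_on_swap) (simp add: case_prod_unfold)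
    then have "(\<lambda>i. \<Sum>\<^sub>\<infinity>m. (1/3) ^ m * (cmod (u m i))\<^sup>2) summable_on UNIV"
      by (rule summable_on_Sigma_banach)
    then have "(\<lambda>i. 3/2 * (\<Sum>\<^sub>\<infinity>m. (1/3) ^ m * (cmod (u m i))\<^sup>2)) summable_on UNIV"
      by (rule summable_on_cmult_right)
    then show "(\<lambda>i. (cmod (b i))\<^sup>2) summable_on UNIV"
      by (rule summable_on_comparison_test) (use b_sq in auto)
  next
    fix n
    have abs: "(\<lambda>p. cmod (case p of (m, i) \<Rightarrow> t m i * g n i)) summable_on UNIV \<times> UNIV"
    proof (rule summable_on_SigmaI[where g="\<lambda>m. (1/3) ^ m * (\<Sum>\<^sub>\<infinity>i. cmod (u m i * g n i))"])
      show "((\<lambda>i. cmod (case (m, i) of (m, i) \<Rightarrow> t m i * g n i)) has_sum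
          (1/3) ^ m * (\<Sum>\<^sub>\<infinity>i. cmod (u m i * g n i))) UNIV" for m
        using has_sum_cmult_right[OF has_sum_infsum[OF ug_sum[of m n]], of "(1/3) ^ m"]
        by (simp add: norm_mult t_norm mult_ac)
      show "(\<lambda>m. (1/3) ^ m * (\<Sum>\<^sub>\<infinity>i. cmod (u m i * g n i))) summable_on UNIV"
        by (rule summable_on_comparison_test[of "\<lambda>m. (1/3) ^ m * N n"])
           (use ug_le in \<open>auto intro!: mult_left_mono mult_nonneg_nonneg infsum_nonneg has_sum_imp_summable
              summable_on_cmult_left has_sum_imp_summable[OF geo']\<close>)
    qed auto
    have "(\<Sum>\<^sub>\<infinity>i. b i * g n i) = (\<Sum>\<^sub>\<infinity>i. \<Sum>\<^sub>\<infinity>m. t m i * g n i)"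
      unfolding b_def by (simp add: infsum_cmult_left[OF abs_summable_summable[OF t_sum]])
    also have "\<dots> = (\<Sum>\<^sub>\<infinity>m. \<Sum>\<^sub>\<infinity>i. t m i * g n i)"
      by (rule infsum_swap_banach[symmetric]) (rule abs_summable_summable[OF abs])
    also have "\<dots> = (\<Sum>\<^sub>\<infinity>m. \<epsilon> m * ((1/3) ^ m * G n m))"
      unfolding G_def t_def mult.assoc infsum_cmult_right' ..
    also have "\<dots> = (\<Sum>m. \<epsilon> m * ((1/3) ^ m * G n m))"
    proof -
      have "(\<lambda>m. cmod (\<epsilon> m * ((1/3) ^ m * G n m))) summable_on UNIV"
        by (rule summable_on_comparison_test[of "\<lambda>m. (1/3) ^ m * N n"])
           (use G_le in \<open>auto intro!: mult_left_mono has_sum_imp_summable summable_on_cmult_left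
              has_sum_imp_summable[OF geo'] simp: norm_mult norm_power norm_divide \<epsilon>\<close>)
      from sums_unique[OF has_sum_imp_sums[OF has_sum_infsum[OF abs_summable_summable[OF this]]]]
      show ?thesis .
    qed
    finally have eq: "(\<Sum>\<^sub>\<infinity>i. b i * g n i) = (\<Sum>m. \<epsilon> m * ((1/3) ^ m * G n m))" .
    let ?a = "\<lambda>m. \<epsilon> m * ((1/3) ^ m * G n m)"
    have a_le: "cmod (?a m) \<le> (1/3) ^ m * N n" for m
      using G_le[of n m] by (auto simp: norm_mult norm_power norm_divide \<epsilon> intro!: mult_left_mono)
    have sm: "summable (\<lambda>m. (1/3) ^ m * N n)" by (rule summable_mult2[OF sums_summable[OF geo]])
    have "summable ?a" by (rule summable_comparison_test'[OF sm, of 0]) (rule a_le)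
    then have split: "(\<Sum>m. ?a m) = (\<Sum>m. ?a (m + Suc n)) + (\<Sum>m<Suc n. ?a m)"
      by (rule suminf_split_initial_segment)
    have tl: "(\<lambda>m. (1/3) ^ (m + Suc n) * N n) sums ((1/3) ^ n / 2 * N n)"
    proof -
      have e1: "q ^ (m + Suc n) * x = q ^ m * (q ^ Suc n * x)" for q x :: real and m
        by (simp only: power_add mult.assoc)
      have "q / 2 * x = 3/2 * ((1/3) * q * x)" for q x :: real by simp
      from this[of "(1/3) ^ n" "N n"]
      have e2: "(1/3) ^ n / 2 * N n = 3/2 * ((1/3) ^ Suc n * N n)" by (simp only: power_Suc)
      show ?thesis
        unfolding e1 e2 using sums_mult2[OF geo, of "(1/3) ^ Suc n * N n"] by assumption
    qed
    have "cmod (\<Sum>m. ?a (m + Suc n)) \<le> (\<Sum>m. (1/3) ^ (m + Suc n) * N n)"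
    proof (rule norm_suminf_le)
      show "cmod (?a (m + Suc n)) \<le> (1/3) ^ (m + Suc n) * N n" for m by (rule a_le)
      show "summable (\<lambda>m. (1/3) ^ (m + Suc n) * N n)" using tl by (rule sums_summable)
    qed
    also have "\<dots> = (1/3) ^ n / 2 * N n" by (rule sums_unique[OF tl, symmetric])
    finally have "cmod (\<Sum>m. ?a (m + Suc n)) \<le> (1/3) ^ n / 2 * N n" .
    moreover have "(1/3) ^ n * N n \<le> cmod (\<Sum>m<Suc n. ?a m)"
      using \<epsilon>_ge[of n] N0[of n] by (simp add: G_diag norm_mult norm_power norm_divide flip: lessThan_Suc_atMost)
    ultimately have "(1/3) ^ n / 2 * N n \<le> cmod (\<Sum>m. ?a m)"
      unfolding split
      using norm_diff_ineq[of "\<Sum>m<Suc n. ?a m" "\<Sum>m. ?a (m + Suc n)"]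
      by (simp add: add.commute)
    then show "(1/3) ^ n / 2 * sqrt (\<Sum>\<^sub>\<infinity>i. (cmod (g n i))\<^sup>2) \<le> cmod (\<Sum>\<^sub>\<infinity>i. b i * g n i)"
      by (simp add: eq N_def)
  qed
qed

section \<open>Parseval on the torus by means over roots of unity\<close>

text \<open>Dominated convergence for sums: an enumeration of the index type reduces it to Tannery's
  theorem for series.\<close>

lemma tannery_infsum:
  fixes a :: "nat \<Rightarrow> 'i::countable \<Rightarrow> complex"
  assumes inf: "infinite (UNIV :: 'i set)"
    and lim: "\<And>x. (\<lambda>n. a n x) \<longlonglongrightarrow> b x"
    and bound: "\<And>n x. cmod (a n x) \<le> M x" and M: "M summable_on UNIV"
  shows "(\<lambda>n. infsum (a n) UNIV) \<longlonglongrightarrow> infsum b UNIV"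
proof -
  define e where "e = (from_nat_into UNIV :: nat \<Rightarrow> 'i)"
  have e: "bij_betw e UNIV UNIV"
    unfolding e_def using inf by (intro bij_betw_from_nat_into) auto
  have suminf: "infsum f UNIV = (\<Sum>k. f (e k))" if "\<And>x. cmod (f x) \<le> M x" for f :: "'i \<Rightarrow> complex"
  proof -
    have "(\<lambda>x. cmod (f x)) summable_on UNIV"
      by (rule summable_on_comparison_test[OF M]) (use that in auto)
    then have "f summable_on UNIV" by (rule abs_summable_summable)
    then have "(\<lambda>k. f (e k)) summable_on UNIV"
      by (simp add: summable_on_reindex_bij_betw[OF e])
    from has_sum_imp_sums[OF has_sum_infsum[OF this]]
    show ?thesis by (simp add: sums_iff infsum_reindex_bij_betw[OF e])
  qed
  have b: "cmod (b x) \<le> M x" for x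
    by (rule LIMSEQ_le_const2[OF tendsto_norm[OF lim]]) (use bound in auto)
  have "(\<lambda>k. M (e k)) summable_on UNIV"
    using M by (simp add: summable_on_reindex_bij_betw[OF e])
  then have "summable (\<lambda>k. M (e k))" by (rule summable_on_imp_summable)
  then have "(\<lambda>n. \<Sum>k. a n (e k)) \<longlonglongrightarrow> (\<Sum>k. b (e k))"
    using tannerys_theorem[of "\<lambda>k n. a n (e k)" "\<lambda>k. b (e k)" sequentially "\<lambda>k. M (e k)"]
      lim bound by (auto simp: always_eventually)
  then show ?thesis
    using suminf[of b, OF b] suminf[of "a _", OF bound] by simp
qed

definition unity_root :: "nat \<Rightarrow> nat \<Rightarrow> complex" where
  "unity_root N i = cis (2 * pi * real i / real N)"

lemma norm_unity_root [simp]: "cmod (unity_root N i) = 1"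
  by (simp add: unity_root_def)

definition root_average :: "nat \<Rightarrow> nat \<Rightarrow> nat \<Rightarrow> complex" where
  "root_average N k l = (\<Sum>i<N. unity_root N i ^ k * cnj (unity_root N i ^ l)) / of_nat N"

lemma norm_root_average: "cmod (root_average N k l) \<le> 1"
proof -
  have "cmod (\<Sum>i<N. unity_root N i ^ k * cnj (unity_root N i ^ l)) \<le> (\<Sum>i<N. 1)"
    by (rule sum_norm_le) (simp add: norm_mult norm_power)
  then show ?thesis
    by (cases "N = 0") (simp_all add: root_average_def norm_divide divide_le_eq)
qed

text \<open>Orthogonality of the characters of \<open>\<int>/N\<int>\<close>, since distinct characters lead to a geometric
  series whose ratio is an \<open>N\<close>-th root of unity other than 1.\<close>

lemma root_average_eq:
  assumes "k < N" "l < N"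
  shows "root_average N k l = (if k = l then 1 else 0)"
proof -
  define z where "z = cis (2 * pi * ((real k - real l) / real N))"
  have "unity_root N i ^ k * cnj (unity_root N i ^ l) = z ^ i" for i
    using assms
    by (simp add: unity_root_def z_def cis_cnj Complex.DeMoivre cis_mult right_diff_distrib
        diff_divide_distrib mult_ac)
  then have eq: "root_average N k l = (\<Sum>i<N. z ^ i) / of_nat N" by (simp add: root_average_def)
  show ?thesis
  proof (cases "k = l")
    case True
    have "z = 1" using True by (simp add: z_def)
    then show ?thesis unfolding eq using assms True by simp
  next
    case False
    have "z \<noteq> 1"
    proof
      assume "z = 1"
      then obtain n where "2 * pi * ((real k - real l) / real N) = of_int n * (2 * pi)"
        unfolding z_def cis_eq_1_iff by blast
      moreover have "x = y" if "2 * pi * x = y * (2 * pi)" for x y :: real using that by simp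
      ultimately have "(real k - real l) / real N = of_int n" by blast
      then have "real k - real l = of_int n * real N" using assms by (simp add: field_simps)
      then have "of_int (int k - int l) = (of_int (n * int N) :: real)" by simp
      then have n: "int k - int l = n * int N" by (simp only: of_int_eq_iff)
      have "\<bar>int k - int l\<bar> < int N" using assms by linarith
      moreover have "1 * int N \<le> \<bar>n\<bar> * int N" if "n \<noteq> 0" using that by (intro mult_right_mono) auto
      ultimately have "n = 0" unfolding n abs_mult by auto
      then show False using n False by simp
    qed
    moreover have "z ^ N = 1"
    proof -
      have "z ^ N = cis (2 * pi * (real k - real l))"
        using assms by (simp add: z_def Complex.DeMoivre)
      also have "\<dots> = 1" by (rule cis_multiple_2pi) simp
      finally show ?thesis .
    qed
    ultimately show ?thesis using False by (simp add: eq geometric_sum)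
  qed
qed

lemma abs_summable_times:
  fixes f :: "'i \<Rightarrow> complex" and g :: "'j \<Rightarrow> complex"
  assumes f: "(\<lambda>p. cmod (f p)) summable_on UNIV" and g: "(\<lambda>q. cmod (g q)) summable_on UNIV"
  shows "(\<lambda>(p, q). cmod (f p * g q)) summable_on UNIV"
proof -
  have "(\<lambda>(p, q). cmod (f p * g q)) summable_on (SIGMA p:UNIV. UNIV)"
  proof (rule summable_on_SigmaI)
    show "((\<lambda>q. case (p, q) of (p, q) \<Rightarrow> cmod (f p * g q)) has_sum
        cmod (f p) * (\<Sum>\<^sub>\<infinity>q. cmod (g q))) UNIV" for p
      by (simp add: norm_mult has_sum_cmult_right[OF has_sum_infsum[OF g]])
    show "(\<lambda>p. cmod (f p) * (\<Sum>\<^sub>\<infinity>q. cmod (g q))) summable_on UNIV"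
      by (rule summable_on_cmult_left[OF f])
  qed auto
  then show ?thesis by simp
qed

lemma summable_on_norm_square:
  fixes d :: "'i \<Rightarrow> complex"
  assumes d: "(\<lambda>p. cmod (d p)) summable_on UNIV"
  shows "(\<lambda>p. (cmod (d p))\<^sup>2) summable_on UNIV"
proof -
  have "inj_on (\<lambda>p. (p, p)) (UNIV :: 'i set)" by (simp add: inj_on_def)
  moreover have "(\<lambda>(p, q). cmod (d p * d q)) summable_on range (\<lambda>p. (p, p))"
    by (rule summable_on_subset[OF abs_summable_times]) (use d in simp_all)
  ultimately show ?thesis
    by (simp add: summable_on_reindex o_def norm_mult power2_eq_square)
qed

lemma infsum_times:
  fixes f :: "'i \<Rightarrow> complex" and g :: "'j \<Rightarrow> complex"
  assumes f: "(\<lambda>p. cmod (f p)) summable_on UNIV" and g: "(\<lambda>q. cmod (g q)) summable_on UNIV"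
  shows "((\<lambda>(p, q). f p * g q) has_sum (infsum f UNIV * infsum g UNIV)) UNIV"
proof -
  have "(\<lambda>pq. cmod (case pq of (p, q) \<Rightarrow> f p * g q)) summable_on UNIV"
    using abs_summable_times[OF f g] by (simp add: case_prod_unfold)
  then have s: "(\<lambda>(p, q). f p * g q) summable_on UNIV" by (rule abs_summable_summable)
  have "infsum (\<lambda>(p, q). f p * g q) UNIV = (\<Sum>\<^sub>\<infinity>p. \<Sum>\<^sub>\<infinity>q. f p * g q)"
    using infsum_Sigma'_banach[of "\<lambda>p q. f p * g q" UNIV "\<lambda>_. UNIV"] s by simp
  also have "\<dots> = infsum f UNIV * infsum g UNIV"
    by (simp add: infsum_cmult_left' infsum_cmult_right')
  finally show ?thesis using has_sum_infsum[OF s] by simp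
qed

lemma has_sum_finite_sum:
  fixes f :: "'k \<Rightarrow> 'i \<Rightarrow> complex"
  assumes "finite I" "\<And>i. i \<in> I \<Longrightarrow> (f i has_sum s i) A"
  shows "((\<lambda>x. \<Sum>i\<in>I. f i x) has_sum (\<Sum>i\<in>I. s i)) A"
  using assms by (induction I rule: finite_induct) (auto intro!: has_sum_add)

text \<open>Means over pairs of \<open>N\<close>-th roots of unity stand in for integrals over the torus. Expanding the
  square gives \<open>\<Sum> d\<^sub>p cnj(d\<^sub>q)\<close> with a factor that averages the character \<open>p - q\<close>. This factor is
  bounded by 1 and is eventually 1 if \<open>p = q\<close> and 0 otherwise, so dominated convergence leaves the
  diagonal.\<close>

lemma torus_Parseval:
  fixes d :: "nat \<times> nat \<Rightarrow> complex"
  assumes d: "(\<lambda>p. cmod (d p)) summable_on UNIV"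
  shows "(\<lambda>N. (\<Sum>i<N. \<Sum>j<N.
        (cmod (\<Sum>\<^sub>\<infinity>(k, l). d (k, l) * unity_root N i ^ k * unity_root N j ^ l))\<^sup>2) / (real N)\<^sup>2)
      \<longlonglongrightarrow> (\<Sum>\<^sub>\<infinity>p. (cmod (d p))\<^sup>2)"
proof -
  define ch where "ch N i j p = unity_root N i ^ fst p * unity_root N j ^ snd p" for N i j and p :: "nat \<times> nat"
  define E where "E N i j = (\<Sum>\<^sub>\<infinity>p. d p * ch N i j p)" for N i j
  have E_eq: "(\<Sum>\<^sub>\<infinity>(k, l). d (k, l) * unity_root N i ^ k * unity_root N j ^ l) = E N i j" for N i j
    unfolding E_def by (rule infsum_cong) (auto simp: ch_def)
  have ch_norm: "cmod (ch N i j p) = 1" for N i j p by (simp add: ch_def norm_mult norm_power)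
  define a where "a N pq = d (fst pq) * cnj (d (snd pq)) *
      (root_average N (fst (fst pq)) (fst (snd pq)) * root_average N (snd (fst pq)) (snd (snd pq)))"
    for N and pq :: "(nat \<times> nat) \<times> (nat \<times> nat)"
  define b where "b pq = (if fst pq = snd pq then d (fst pq) * cnj (d (snd pq)) else 0)"
    for pq :: "(nat \<times> nat) \<times> (nat \<times> nat)"
  have avg: "complex_of_real ((\<Sum>i<N. \<Sum>j<N. (cmod (E N i j))\<^sup>2) / (real N)\<^sup>2) = infsum (a N) UNIV" for N
  proof -
    have sq: "((\<lambda>(p, q). (d p * ch N i j p) * cnj (d q * ch N i j q)) has_sum
        complex_of_real ((cmod (E N i j))\<^sup>2)) UNIV" for i j
    proof -
      have "((\<lambda>(p, q). (d p * ch N i j p) * cnj (d q * ch N i j q)) has_sum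
         (\<Sum>\<^sub>\<infinity>p. d p * ch N i j p) * (\<Sum>\<^sub>\<infinity>q. cnj (d q * ch N i j q))) UNIV"
        by (rule infsum_times) (use d in \<open>simp_all add: norm_mult ch_norm\<close>)
      then show ?thesis by (simp only: infsum_cnj E_def complex_norm_square)
    qed
    have "((\<lambda>x. \<Sum>i<N. \<Sum>j<N. case x of (p, q) \<Rightarrow> (d p * ch N i j p) * cnj (d q * ch N i j q)) has_sum
        (\<Sum>i<N. \<Sum>j<N. complex_of_real ((cmod (E N i j))\<^sup>2))) UNIV"
      by (rule has_sum_finite_sum, simp, rule has_sum_finite_sum, simp, rule sq)
    then have "((\<lambda>x. (\<Sum>i<N. \<Sum>j<N. case x of (p, q) \<Rightarrow> (d p * ch N i j p) * cnj (d q * ch N i j q))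
          * inverse ((of_nat N)\<^sup>2)) has_sum
        (\<Sum>i<N. \<Sum>j<N. complex_of_real ((cmod (E N i j))\<^sup>2)) * inverse ((of_nat N)\<^sup>2)) UNIV"
      by (rule has_sum_cmult_left)
    moreover have "(\<Sum>i<N. \<Sum>j<N. case x of (p, q) \<Rightarrow> (d p * ch N i j p) * cnj (d q * ch N i j q))
          * inverse ((of_nat N)\<^sup>2) = a N x" for x
    proof -
      obtain k l k' l' where x: "x = ((k, l), (k', l'))" by (metis surj_pair)
      have "(\<Sum>i<N. \<Sum>j<N. (d (k, l) * ch N i j (k, l)) * cnj (d (k', l') * ch N i j (k', l')))
        = d (k, l) * cnj (d (k', l')) * (\<Sum>i<N. \<Sum>j<N.
            (unity_root N i ^ k * cnj (unity_root N i ^ k')) * (unity_root N j ^ l * cnj (unity_root N j ^ l')))"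
        unfolding sum_distrib_left ch_def by (intro sum.cong refl) (simp add: mult_ac)
      also have "\<dots> = d (k, l) * cnj (d (k', l')) *
          ((\<Sum>i<N. unity_root N i ^ k * cnj (unity_root N i ^ k'))
           * (\<Sum>j<N. unity_root N j ^ l * cnj (unity_root N j ^ l')))"
        by (simp only: sum_product)
      finally show ?thesis
        unfolding x a_def root_average_def by (simp add: divide_inverse power2_eq_square mult_ac)
    qed
    ultimately have "(a N has_sum
        (\<Sum>i<N. \<Sum>j<N. complex_of_real ((cmod (E N i j))\<^sup>2)) * inverse ((of_nat N)\<^sup>2)) UNIV"
      by simp
    then have "infsum (a N) UNIV = (\<Sum>i<N. \<Sum>j<N. complex_of_real ((cmod (E N i j))\<^sup>2)) * inverse ((of_nat N)\<^sup>2)"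
      by (rule infsumI)
    then show ?thesis by (simp add: divide_inverse)
  qed
  have "(\<lambda>N. infsum (a N) UNIV) \<longlonglongrightarrow> infsum b UNIV"
  proof (rule tannery_infsum)
    show "infinite (UNIV :: ((nat \<times> nat) \<times> (nat \<times> nat)) set)"
      by (simp add: finite_prod)
  next
    fix x :: "(nat \<times> nat) \<times> (nat \<times> nat)"
    obtain k l k' l' where x: "x = ((k, l), (k', l'))" by (metis surj_pair)
    have "\<forall>\<^sub>F N in sequentially. a N x = b x"
      using eventually_gt_at_top[of "max (max k l) (max k' l')"]
      by eventually_elim (auto simp: x a_def b_def root_average_eq)
    then show "(\<lambda>N. a N x) \<longlonglongrightarrow> b x" by (rule tendsto_eventually)
  next
    fix N x
    have "cmod (root_average N k k' * root_average N l l') \<le> 1 * 1" for k k' l l'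
      unfolding norm_mult by (intro mult_mono norm_root_average) auto
    then have "cmod (d p * cnj (d q) * (root_average N k k' * root_average N l l')) \<le> cmod (d p * cnj (d q)) * (1 * 1)"
      for p q k k' l l'
      unfolding norm_mult[of "d p * cnj (d q)"] by (intro mult_left_mono) auto
    then show "cmod (a N x) \<le> (\<lambda>(p, q). cmod (d p * cnj (d q))) x"
      by (simp add: a_def case_prod_unfold)
  next
    show "(\<lambda>(p, q). cmod (d p * cnj (d q))) summable_on UNIV"
      by (rule abs_summable_times) (use d in simp_all)
  qed
  moreover have "infsum b UNIV = complex_of_real (\<Sum>\<^sub>\<infinity>p. (cmod (d p))\<^sup>2)"
  proof -
    have sm: "(\<lambda>p. (cmod (d p))\<^sup>2) summable_on UNIV"
      by (rule summable_on_norm_square[OF d])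
    have "infsum b UNIV = infsum b (range (\<lambda>p. (p, p)))"
      by (rule infsum_cong_neutral) (auto simp: b_def)
    also have "\<dots> = (\<Sum>\<^sub>\<infinity>p. b (p, p))"
      by (subst infsum_reindex) (simp_all add: inj_on_def o_def)
    also have "\<dots> = (\<Sum>\<^sub>\<infinity>p. complex_of_real ((cmod (d p))\<^sup>2))"
      by (simp only: b_def fst_conv snd_conv refl if_True complex_norm_square)
    also have "\<dots> = complex_of_real (\<Sum>\<^sub>\<infinity>p. (cmod (d p))\<^sup>2)"
      by (rule infsumI, rule has_sum_of_real, rule has_sum_infsum[OF sm])
    finally show ?thesis .
  qed
  ultimately have "(\<lambda>N. complex_of_real ((\<Sum>i<N. \<Sum>j<N. (cmod (E N i j))\<^sup>2) / (real N)\<^sup>2))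
      \<longlonglongrightarrow> complex_of_real (\<Sum>\<^sub>\<infinity>p. (cmod (d p))\<^sup>2)"
    by (simp only: avg)
  then show ?thesis unfolding E_eq by (simp only: tendsto_of_real_iff)
qed

section \<open>Power series of separately holomorphic functions\<close>

text \<open>Cauchy's formula expresses the derivative as an integral over a circle that can be kept
  fixed while the point varies in a smaller disc, and the integrand is jointly continuous.\<close>

lemma continuous_on_partial_deriv:
  fixes g :: "complex \<times> complex \<Rightarrow> complex"
  assumes cont: "continuous_on (ball 0 1 \<times> ball 0 1) g"
    and hol: "\<And>z. z \<in> ball 0 1 \<Longrightarrow> (\<lambda>w. g (z, w)) holomorphic_on ball 0 1"
  shows "continuous_on (ball 0 1 \<times> ball 0 1) (\<lambda>(z, w). deriv (\<lambda>v. g (z, v)) w)"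
proof -
  have local: "continuous_on (ball 0 1 \<times> ball 0 R) (\<lambda>(z, w). deriv (\<lambda>v. g (z, v)) w)"
    if R: "0 < R" "R < 1" for R
  proof -
    let ?\<gamma> = "circlepath 0 R"
    have \<gamma>: "?\<gamma> t = of_real R * exp (2 * of_real pi * \<i> * of_real t)" for t
      by (simp add: circlepath)
    have \<gamma>_norm: "cmod (?\<gamma> t) = R" for t
      using R by (simp add: \<gamma> norm_mult)
    define F where "F p t = g (fst p, ?\<gamma> t) / (?\<gamma> t - snd p)\<^sup>2 *
        (2 * pi * \<i> * R * exp (2 * of_real pi * \<i> * of_real t))" for p :: "complex \<times> complex" and t :: real
    have "continuous_on ((ball 0 1 \<times> ball 0 R) \<times> cbox 0 1) (\<lambda>(p, t). F p t)"
      unfolding F_def case_prod_unfold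
    proof (intro continuous_intros)
      have \<gamma>c: "continuous_on S (\<lambda>x :: (complex \<times> complex) \<times> real. ?\<gamma> (snd x))" for S
        unfolding \<gamma> by (intro continuous_intros)
      show "continuous_on ((ball 0 1 \<times> ball 0 R) \<times> cbox 0 1)
          (\<lambda>x :: (complex \<times> complex) \<times> real. ?\<gamma> (snd x))" by (rule \<gamma>c)
      show "continuous_on ((ball 0 1 \<times> ball 0 R) \<times> cbox 0 1)
          (\<lambda>x :: (complex \<times> complex) \<times> real. g (fst (fst x), ?\<gamma> (snd x)))"
        by (rule continuous_on_compose2[OF cont])
           (use R \<gamma>_norm in \<open>auto intro!: continuous_intros \<gamma>c\<close>)
      show "\<forall>x\<in>(ball 0 1 \<times> ball 0 R) \<times> cbox 0 1.
          (?\<gamma> (snd x) - snd (fst x :: complex \<times> complex))\<^sup>2 \<noteq> 0"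
        using \<gamma>_norm by fastforce
    qed
    then have "continuous_on (ball 0 1 \<times> ball 0 R) (\<lambda>p. integral (cbox 0 1) (F p))"
      by (rule integral_continuous_on_param)
    then have "continuous_on (ball 0 1 \<times> ball 0 R)
        (\<lambda>p. 1 / (2 * of_real pi * \<i>) * integral (cbox 0 1) (F p))"
      by (rule continuous_on_mult_left)
    moreover have "deriv (\<lambda>v. g (z, v)) w = 1 / (2 * of_real pi * \<i>) * integral (cbox 0 1) (F (z, w))"
      if "z \<in> ball 0 1" "w \<in> ball 0 R" for z w
    proof -
      have sub: "cball 0 R \<subseteq> ball (0 :: complex) 1" "ball 0 R \<subseteq> ball (0 :: complex) 1"
        using R by auto
      have "((\<lambda>v. g (z, v)) has_field_derivative
          (1 / (2 * of_real pi * \<i>) * contour_integral ?\<gamma> (\<lambda>u. g (z, u) / (u - w)\<^sup>2))) (at w)"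
        using holomorphic_on_imp_continuous_on[OF holomorphic_on_subset[OF hol[OF that(1)] sub(1)]]
          holomorphic_on_subset[OF hol[OF that(1)] sub(2)] that(2)
        by (rule Cauchy_derivative_integral_circlepath(2))
      then have "deriv (\<lambda>v. g (z, v)) w =
          1 / (2 * of_real pi * \<i>) * contour_integral ?\<gamma> (\<lambda>u. g (z, u) / (u - w)\<^sup>2)"
        by (rule DERIV_imp_deriv)
      then show ?thesis
        by (simp add: contour_integral_integral vector_derivative_circlepath F_def[abs_def])
    qed
    ultimately show ?thesis
      by (subst continuous_on_cong[OF refl]) (auto simp: case_prod_unfold)
  qed
  show ?thesis
  proof (rule continuous_at_imp_continuous_on, rule ballI)
    fix p :: "complex \<times> complex" assume p: "p \<in> ball 0 1 \<times> ball 0 1"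
    then have "cmod (snd p) < 1" by auto
    then obtain R where R: "cmod (snd p) < R" "R < 1" using dense by blast
    have "0 < R" using R(1) norm_ge_zero[of "snd p"] by linarith
    from local[OF this R(2)] show "isCont (\<lambda>(z, w). deriv (\<lambda>v. g (z, v)) w) p"
      using p R(1) by (subst (asm) continuous_on_eq_continuous_at) (auto simp: open_Times)
  qed
qed

text \<open>The Taylor coefficients in \<open>z\<close> are integrals over the circle \<open>|z| = 1/2\<close>, and these can be
  differentiated in \<open>w\<close> under the integral sign. The radius does not depend on \<open>w\<close>, so holomorphy
  follows on the whole disc.\<close>

lemma holomorphic_on_taylor_coefficient:
  fixes g :: "complex \<times> complex \<Rightarrow> complex"
  assumes cont: "continuous_on (ball 0 1 \<times> ball 0 1) g"
    and hz: "\<And>w. w \<in> ball 0 1 \<Longrightarrow> (\<lambda>z. g (z, w)) holomorphic_on ball 0 1"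
    and hw: "\<And>z. z \<in> ball 0 1 \<Longrightarrow> (\<lambda>w. g (z, w)) holomorphic_on ball 0 1"
  shows "(\<lambda>w. (deriv ^^ k) (\<lambda>z. g (z, w)) 0) holomorphic_on ball 0 1"
proof -
  let ?\<gamma> = "circlepath 0 (1/2)"
  have \<gamma>: "?\<gamma> t = of_real (1/2) * exp (2 * of_real pi * \<i> * of_real t)" for t
    by (simp add: circlepath)
  have \<gamma>_norm: "cmod (?\<gamma> t) = 1/2" for t
    unfolding \<gamma> norm_mult by simp
  have \<gamma>_lt: "cmod (?\<gamma> t) < 1" for t
    by (simp add: \<gamma>_norm)
  have \<gamma>c: "continuous_on S ?\<gamma>" for S
    unfolding \<gamma>[abs_def] by (intro continuous_intros)
  define K where "K t = 2 * pi * \<i> * (1/2) * exp (2 * of_real pi * \<i> * of_real t) / ?\<gamma> t ^ Suc k" for t :: real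
  have Kc: "continuous_on S K" for S
    unfolding K_def using \<gamma>_norm by (intro continuous_intros \<gamma>c) (metis norm_zero power_not_zero zero_neq_one divide_eq_0_iff zero_neq_numeral)
  have "(\<lambda>w. integral (cbox 0 1) (\<lambda>t. g (?\<gamma> t, w) * K t)) holomorphic_on ball 0 1"
  proof (rule leibniz_rule_holomorphic)
    fix w :: complex and t :: real assume w: "w \<in> ball 0 1" and "t \<in> cbox 0 1"
    have "?\<gamma> t \<in> ball 0 1" using \<gamma>_norm[of t] by simp
    then have "(\<lambda>v. g (?\<gamma> t, v)) field_differentiable at w"
      using hw w by (meson holomorphic_on_imp_differentiable_at open_ball)
    then have "((\<lambda>v. g (?\<gamma> t, v)) has_field_derivative deriv (\<lambda>v. g (?\<gamma> t, v)) w) (at w)"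
      by (simp add: DERIV_deriv_iff_field_differentiable)
    then show "((\<lambda>v. g (?\<gamma> t, v) * K t) has_field_derivative deriv (\<lambda>v. g (?\<gamma> t, v)) w * K t) (at w within ball 0 1)"
      by (rule DERIV_cmult_right[OF has_field_derivative_at_within])
  next
    fix w :: complex assume w: "w \<in> ball 0 1"
    have "continuous_on (cbox 0 1) (\<lambda>t. g (?\<gamma> t, w))"
      by (rule continuous_on_compose2[OF cont])
         (use w \<gamma>_lt in \<open>auto intro!: continuous_intros \<gamma>c\<close>)
    then show "(\<lambda>t. g (?\<gamma> t, w) * K t) integrable_on cbox 0 1"
      by (intro integrable_continuous continuous_on_mult Kc)
  next
    have "continuous_on (ball 0 1 \<times> cbox 0 1)
        (\<lambda>x. (\<lambda>(z, w). deriv (\<lambda>v. g (z, v)) w) (?\<gamma> (snd x), fst x))"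
      by (rule continuous_on_compose2[OF continuous_on_partial_deriv[OF cont hw]])
         (use \<gamma>_lt in \<open>auto intro!: continuous_intros continuous_on_compose2[OF \<gamma>c]\<close>)
    then show "continuous_on (ball 0 1 \<times> cbox 0 1) (\<lambda>(w, t). deriv (\<lambda>v. g (?\<gamma> t, v)) w * K t)"
      unfolding case_prod_unfold fst_conv snd_conv
      by (intro continuous_on_mult continuous_on_compose2[OF Kc] continuous_intros) auto
  qed auto
  then have "(\<lambda>w. fact k / (2 * pi * \<i>) * integral (cbox 0 1) (\<lambda>t. g (?\<gamma> t, w) * K t)) holomorphic_on ball 0 1"
    by (intro holomorphic_intros)
  moreover have "(deriv ^^ k) (\<lambda>z. g (z, w)) 0
      = fact k / (2 * pi * \<i>) * integral (cbox 0 1) (\<lambda>t. g (?\<gamma> t, w) * K t)" if "w \<in> ball 0 1" for w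
  proof -
    have sub: "cball 0 (1/2) \<subseteq> ball (0 :: complex) 1" "ball 0 (1/2) \<subseteq> ball (0 :: complex) 1" by auto
    have "(deriv ^^ k) (\<lambda>z. g (z, w)) 0
        = fact k / (2 * pi * \<i>) * contour_integral ?\<gamma> (\<lambda>u. g (u, w) / (u - 0) ^ Suc k)"
      by (rule Cauchy_higher_derivative_integral_circlepath(2)
          [OF holomorphic_on_imp_continuous_on[OF holomorphic_on_subset[OF hz[OF that] sub(1)]]
              holomorphic_on_subset[OF hz[OF that] sub(2)]]) simp
    then show ?thesis
      by (simp add: contour_integral_integral vector_derivative_circlepath K_def)
  qed
  ultimately show ?thesis
    using holomorphic_cong by (metis (no_types, lifting))
qed

text \<open>Expand in \<open>z\<close> first, and then each coefficient in \<open>w\<close>. For every \<open>r < 1\<close>, Cauchy's inequality,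
  applied once in each variable, bounds the coefficient of \<open>z\<^sup>k w\<^sup>l\<close> by \<open>M r\<^sup>-\<^sup>k\<^sup>-\<^sup>l\<close>; hence the double
  series converges absolutely and its sum may be evaluated iteratively.\<close>

lemma separately_holomorphic_power_series:
  fixes g :: "complex \<times> complex \<Rightarrow> complex"
  assumes cont: "continuous_on (ball 0 1 \<times> ball 0 1) g"
    and hz: "\<And>w. w \<in> ball 0 1 \<Longrightarrow> (\<lambda>z. g (z, w)) holomorphic_on ball 0 1"
    and hw: "\<And>z. z \<in> ball 0 1 \<Longrightarrow> (\<lambda>w. g (z, w)) holomorphic_on ball 0 1"
  obtains c where "\<And>z w. z \<in> ball 0 1 \<Longrightarrow> w \<in> ball 0 1 \<Longrightarrow>
      ((\<lambda>(k, l). c (k, l) * z ^ k * w ^ l) has_sum g (z, w)) UNIV"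
proof -
  define H where "H k w = (deriv ^^ k) (\<lambda>z. g (z, w)) 0 / fact k" for k w
  have H_hol: "H k holomorphic_on ball 0 1" for k
    unfolding H_def[abs_def] by (intro holomorphic_intros holomorphic_on_taylor_coefficient[OF cont hz hw]) auto
  have H_sums: "(\<lambda>k. H k w * z ^ k) sums g (z, w)" if "z \<in> ball 0 1" "w \<in> ball 0 1" for z w
    using holomorphic_power_series[OF hz[OF that(2)] that(1)] by (simp add: H_def)
  define c where "c p = (deriv ^^ snd p) (H (fst p)) 0 / fact (snd p)" for p :: "nat \<times> nat"
  have c_sums: "(\<lambda>l. c (k, l) * w ^ l) sums H k w" if "w \<in> ball 0 1" for k w
    using holomorphic_power_series[OF H_hol that, of k] by (simp add: c_def)
  have "((\<lambda>(k, l). c (k, l) * z ^ k * w ^ l) has_sum g (z, w)) UNIV"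
    if zw: "z \<in> ball 0 1" "w \<in> ball 0 1" for z w
  proof -
    have "max (cmod z) (cmod w) < 1" using zw by simp
    then obtain r where r: "max (cmod z) (cmod w) < r" "r < 1" using dense by blast
    then have r0: "0 < r" using norm_ge_zero[of z] by linarith
    have sub: "cball 0 r \<subseteq> ball (0 :: complex) 1" "ball 0 r \<subseteq> ball (0 :: complex) 1" using r by auto
    have "compact (g ` (cball 0 r \<times> cball 0 r))"
      using sub by (intro compact_continuous_image compact_Times compact_cball
          continuous_on_subset[OF cont] Sigma_mono) auto
    then obtain M where M: "\<And>x. x \<in> cball 0 r \<times> cball 0 r \<Longrightarrow> cmod (g x) \<le> M"
      by (meson bounded_iff compact_imp_bounded imageI)
    have H_le: "cmod (H k v) \<le> M / r ^ k" if v: "v \<in> cball 0 r" for k v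
    proof -
      have v1: "v \<in> ball 0 1" using v sub by blast
      have "cmod ((deriv ^^ k) (\<lambda>z. g (z, v)) 0) \<le> fact k * M / r ^ k"
        by (rule Cauchy_inequality[OF holomorphic_on_subset[OF hz[OF v1] sub(2)]
             holomorphic_on_imp_continuous_on[OF holomorphic_on_subset[OF hz[OF v1] sub(1)]] r0])
           (use v M in auto)
      then show ?thesis by (simp add: H_def norm_divide field_simps)
    qed
    have c_le: "cmod (c (k, l)) \<le> M / r ^ k / r ^ l" for k l
    proof -
      have "cmod ((deriv ^^ l) (H k) 0) \<le> fact l * (M / r ^ k) / r ^ l"
        by (rule Cauchy_inequality[OF holomorphic_on_subset[OF H_hol sub(2)]
             holomorphic_on_imp_continuous_on[OF holomorphic_on_subset[OF H_hol sub(1)]] r0])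
           (use H_le in auto)
      then show ?thesis by (simp add: c_def norm_divide field_simps)
    qed
    let ?x = "cmod z / r" and ?y = "cmod w / r"
    have xy: "0 \<le> ?x" "?x < 1" "0 \<le> ?y" "?y < 1" using r r0 by auto
    have "((\<lambda>k. M * ?x ^ k) has_sum M * (1 / (1 - ?x))) UNIV"
      using xy by (intro has_sum_cmult_right sums_nonneg_imp_has_sum geometric_sums) auto
    then have "(\<lambda>k. (M * ?x ^ k) * (1 / (1 - ?y))) summable_on UNIV"
      by (intro summable_on_cmult_left) (rule has_sum_imp_summable)
    moreover have "((\<lambda>l. ?y ^ l) has_sum 1 / (1 - ?y)) UNIV"
      using xy by (intro sums_nonneg_imp_has_sum geometric_sums) auto
    moreover have "0 \<le> M" using M[of "(0, 0)"] r0 norm_ge_zero order_trans by (metis SigmaI centre_in_cball less_imp_le)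
    ultimately have "(\<lambda>(k, l). M * ?x ^ k * ?y ^ l) summable_on (SIGMA k:UNIV. UNIV)"
      using xy by (intro summable_on_SigmaI[where g="\<lambda>k. (M * ?x ^ k) * (1 / (1 - ?y))"])
        (simp_all only: prod.case has_sum_cmult_right mult_nonneg_nonneg zero_le_power)
    then have "(\<lambda>(k, l). M * ?x ^ k * ?y ^ l) summable_on UNIV" by simp
    then have abs: "(\<lambda>p. cmod (case p of (k, l) \<Rightarrow> c (k, l) * z ^ k * w ^ l)) summable_on UNIV"
    proof (rule summable_on_comparison_test)
      fix p :: "nat \<times> nat"
      obtain k l where p: "p = (k, l)" by (metis surj_pair)
      have "cmod (c (k, l)) * (cmod z ^ k * cmod w ^ l) \<le> M / r ^ k / r ^ l * (cmod z ^ k * cmod w ^ l)"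
        by (intro mult_right_mono c_le) auto
      then show "cmod (case p of (k, l) \<Rightarrow> c (k, l) * z ^ k * w ^ l) \<le> (case p of (k, l) \<Rightarrow> M * ?x ^ k * ?y ^ l)"
        by (simp add: p norm_mult norm_power power_divide mult_ac)
    qed auto
    have s: "(\<lambda>(k, l). c (k, l) * z ^ k * w ^ l) summable_on UNIV \<times> UNIV"
      using abs_summable_summable[OF abs] by simp
    have in1: "(\<lambda>l. c (k, l) * z ^ k * w ^ l) summable_on UNIV" for k
      using summable_on_SigmaD1[OF s, of k] by simp
    have inner: "(\<Sum>\<^sub>\<infinity>l. c (k, l) * z ^ k * w ^ l) = H k w * z ^ k" for k
    proof -
      have "(\<lambda>l. c (k, l) * z ^ k * w ^ l) sums (H k w * z ^ k)"
        using sums_mult2[OF c_sums[OF zw(2)], of k "z ^ k"] by (simp add: mult_ac)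
      with has_sum_imp_sums[OF has_sum_infsum[OF in1[of k]]] show ?thesis by (rule sums_unique2)
    qed
    have out: "(\<lambda>k. H k w * z ^ k) summable_on UNIV"
      using summable_on_Sigma_banach[OF s] by (simp add: inner)
    have "infsum (\<lambda>(k, l). c (k, l) * z ^ k * w ^ l) UNIV = (\<Sum>\<^sub>\<infinity>k. H k w * z ^ k)"
      using infsum_Sigma'_banach[OF s] by (simp add: inner)
    also have "\<dots> = g (z, w)"
      by (rule sums_unique2[OF has_sum_imp_sums[OF has_sum_infsum[OF out]] H_sums[OF zw]])
    finally show ?thesis using has_sum_infsum[OF s] by simp
  qed
  then show ?thesis by (rule that)
qed

section \<open>The spaces and their point evaluations\<close>

lemma summable_on_comparable_weights:
  fixes u v x :: "'i \<Rightarrow> real"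
  assumes le: "\<And>p. v p \<le> K * u p" and x0: "\<And>p. 0 \<le> x p" and v0: "\<And>p. 0 \<le> v p"
    and u: "(\<lambda>p. x p * u p) summable_on UNIV"
  shows "(\<lambda>p. x p * v p) summable_on UNIV"
proof (rule summable_on_comparison_test[OF summable_on_cmult_right[OF u, of K]])
  show "x p * v p \<le> K * (x p * u p)" for p
    using mult_left_mono[OF le x0, of p p] by (simp add: mult_ac)
qed (simp add: x0 v0)

definition bidisc_weight :: "real \<Rightarrow> real \<Rightarrow> nat \<times> nat \<Rightarrow> real" where
  "bidisc_weight s t p = beta_weight s (fst p) * beta_weight t (snd p)"

lemma bidisc_weight_pos: "0 < s \<Longrightarrow> 0 < t \<Longrightarrow> 0 < bidisc_weight s t p"
  by (simp add: bidisc_weight_def beta_weight_pos)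

lemma summable_on_bidisc_weight_iff:
  fixes x :: "nat \<times> nat \<Rightarrow> real"
  assumes s: "0 < s" and t: "0 < t" and x0: "\<And>p. 0 \<le> x p"
  shows "(\<lambda>(k, l). x (k, l) * (real k + 1) powr (-s) * (real l + 1) powr (-t)) summable_on UNIV
    \<longleftrightarrow> (\<lambda>p. x p * bidisc_weight s t p) summable_on UNIV"
proof -
  define u where "u p = (real (fst p) + 1) powr (-s) * (real (snd p) + 1) powr (-t)" for p :: "nat \<times> nat"
  have eq: "(\<lambda>(k, l). x (k, l) * (real k + 1) powr (-s) * (real l + 1) powr (-t)) = (\<lambda>p. x p * u p)"
    by (auto simp: u_def mult.assoc)
  obtain c C where c: "0 < c" "0 < C" "\<And>k. c * (real k + 1) powr (-s) \<le> beta_weight s k"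
    "\<And>k. beta_weight s k \<le> C * (real k + 1) powr (-s)"
    using beta_weight_comparable[OF s] by blast
  obtain d D where d: "0 < d" "0 < D" "\<And>k. d * (real k + 1) powr (-t) \<le> beta_weight t k"
    "\<And>k. beta_weight t k \<le> D * (real k + 1) powr (-t)"
    using beta_weight_comparable[OF t] by blast
  have u0: "0 \<le> u p" for p by (simp add: u_def)
  have W0: "0 \<le> bidisc_weight s t p" for p by (rule less_imp_le[OF bidisc_weight_pos[OF s t]])
  have up: "bidisc_weight s t p \<le> (C * D) * u p" for p
  proof -
    have "bidisc_weight s t p \<le> (C * (real (fst p) + 1) powr (-s)) * (D * (real (snd p) + 1) powr (-t))"
      unfolding bidisc_weight_def
      by (rule mult_mono) (use c d beta_weight_pos[OF t] in \<open>auto intro: less_imp_le\<close>)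
    then show ?thesis by (simp add: u_def mult_ac)
  qed
  have lo: "u p \<le> inverse (c * d) * bidisc_weight s t p" for p
  proof -
    have "(c * (real (fst p) + 1) powr (-s)) * (d * (real (snd p) + 1) powr (-t)) \<le> bidisc_weight s t p"
      unfolding bidisc_weight_def
      by (rule mult_mono) (use c d beta_weight_pos[OF s] in \<open>auto intro: less_imp_le\<close>)
    then have "(c * d) * u p \<le> bidisc_weight s t p" by (simp add: u_def mult_ac)
    moreover have "0 < c * d" using c d by simp
    ultimately have "u p \<le> bidisc_weight s t p / (c * d)" by (simp only: pos_le_divide_eq mult.commute)
    then show ?thesis by (simp only: divide_inverse mult.commute)
  qed
  show ?thesis
    unfolding eq
    using summable_on_comparable_weights[of _ "C * D" u x, OF up x0 W0]
      summable_on_comparable_weights[of u "inverse (c * d)" _ x, OF lo x0 u0] by blast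
qed

text \<open>Comparable weights give the same space, so all norm computations may use the Beta weights.\<close>

lemma mem_D_space_iff:
  assumes "0 < s" "0 < t"
  shows "f \<in> D_space (-s, -t) \<longleftrightarrow> (\<exists>a :: nat \<times> nat \<Rightarrow> complex.
      (\<lambda>p. (cmod (a p))\<^sup>2 * bidisc_weight s t p) summable_on UNIV \<and>
      (\<forall>(z, w)\<in>bidisc. ((\<lambda>(k, l). a (k, l) * z ^ k * w ^ l) has_sum f (z, w)) UNIV))"
  unfolding D_space_def
  using summable_on_bidisc_weight_iff[OF assms, of "\<lambda>p. (cmod (_ p))\<^sup>2"] by simp

text \<open>The square of the norm of the evaluation at a point, that is, the reproducing kernel on the
  diagonal, for the norm given by the Beta weights.\<close>

definition kernel_diagonal :: "real \<Rightarrow> real \<Rightarrow> complex \<times> complex \<Rightarrow> real" where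
  "kernel_diagonal s t p = s * (1 - (cmod (fst p))\<^sup>2) powr (-s - 1) * (t * (1 - (cmod (snd p))\<^sup>2) powr (-t - 1))"

text \<open>The evaluation at \<open>q\<close> as a vector of \<open>\<ell>\<^sup>2\<close>, after the isometry that multiplies the coefficients by
  the square root of the weight.\<close>

definition evaluation_vector :: "real \<Rightarrow> real \<Rightarrow> complex \<times> complex \<Rightarrow> nat \<times> nat \<Rightarrow> complex" where
  "evaluation_vector s t q p = fst q ^ fst p * snd q ^ snd p / of_real (sqrt (bidisc_weight s t p))"

lemma evaluation_vector_has_sum:
  assumes s: "0 < s" and t: "0 < t" and q: "q \<in> bidisc"
  shows "((\<lambda>p. (cmod (evaluation_vector s t q p))\<^sup>2) has_sum kernel_diagonal s t q) UNIV"
proof -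
  define x y where "x = (cmod (fst q))\<^sup>2" and "y = (cmod (snd q))\<^sup>2"
  have xy: "0 \<le> x" "x < 1" "0 \<le> y" "y < 1"
    using q by (auto simp: x_def y_def bidisc_def abs_square_less_1)
  have nn: "0 \<le> r ^ k / beta_weight u k" if "0 \<le> r" "0 < u" for r u k
    using that beta_weight_pos[of u k] by simp
  have "((\<lambda>(k, l). x ^ k / beta_weight s k * (y ^ l / beta_weight t l)) has_sum
      (s * (1 - x) powr (-s - 1)) * (t * (1 - y) powr (-t - 1))) UNIV"
    by (rule has_sum_double_product)
       (use xy s t in \<open>auto intro!: sums_nonneg_imp_has_sum sums_inverse_beta_weight nn\<close>)
  moreover have "(\<lambda>(k, l). x ^ k / beta_weight s k * (y ^ l / beta_weight t l))
      = (\<lambda>p. (cmod (evaluation_vector s t q p))\<^sup>2)"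
  proof
    fix p :: "nat \<times> nat"
    have "0 < bidisc_weight s t p" by (rule bidisc_weight_pos[OF s t])
    then have "(cmod (evaluation_vector s t q p))\<^sup>2
        = ((cmod (fst q))^ fst p)\<^sup>2 * ((cmod (snd q)) ^ snd p)\<^sup>2 / bidisc_weight s t p"
      by (simp add: evaluation_vector_def norm_divide norm_mult norm_power power_divide power_mult_distrib)
    then show "(case p of (k, l) \<Rightarrow> x ^ k / beta_weight s k * (y ^ l / beta_weight t l))
      = (cmod (evaluation_vector s t q p))\<^sup>2"
      by (simp add: case_prod_unfold x_def y_def bidisc_weight_def flip: power_mult)
         (simp add: mult.commute)
  qed
  ultimately show ?thesis by (simp add: kernel_diagonal_def x_def y_def)
qed

lemma evaluation_vector_mult:
  assumes "0 < s" "0 < t"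
  shows "(a p * of_real (sqrt (bidisc_weight s t p))) * evaluation_vector s t q p
    = a p * fst q ^ fst p * snd q ^ snd p"
  using bidisc_weight_pos[OF assms, of p] by (simp add: evaluation_vector_def)

lemma point_evaluation:
  assumes s: "0 < s" and t: "0 < t" and q: "q \<in> bidisc"
    and a: "(\<lambda>p. (cmod (a p))\<^sup>2 * bidisc_weight s t p) summable_on UNIV"
  shows "(\<lambda>p. cmod (a p * fst q ^ fst p * snd q ^ snd p)) summable_on UNIV"
    and "cmod (\<Sum>\<^sub>\<infinity>p. a p * fst q ^ fst p * snd q ^ snd p)
      \<le> sqrt (\<Sum>\<^sub>\<infinity>p. (cmod (a p))\<^sup>2 * bidisc_weight s t p) * sqrt (kernel_diagonal s t q)"
proof -
  define u where "u p = a p * of_real (sqrt (bidisc_weight s t p))" for p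
  have W: "0 < bidisc_weight s t p" for p by (rule bidisc_weight_pos[OF s t])
  have u_sq: "(cmod (u p))\<^sup>2 = (cmod (a p))\<^sup>2 * bidisc_weight s t p" for p
    using W[of p] by (simp add: u_def norm_mult power_mult_distrib)
  have u: "(\<lambda>p. (cmod (u p))\<^sup>2) summable_on UNIV" unfolding u_sq by (rule a)
  note ev = evaluation_vector_has_sum[OF s t q]
  have eq: "u p * evaluation_vector s t q p = a p * fst q ^ fst p * snd q ^ snd p" for p
    unfolding u_def by (rule evaluation_vector_mult[OF s t])
  show 1: "(\<lambda>p. cmod (a p * fst q ^ fst p * snd q ^ snd p)) summable_on UNIV"
    using l2_Cauchy_Schwarz(1)[OF u has_sum_imp_summable[OF ev]] by (simp only: eq)
  have "cmod (\<Sum>\<^sub>\<infinity>p. a p * fst q ^ fst p * snd q ^ snd p) \<le> (\<Sum>\<^sub>\<infinity>p. cmod (a p * fst q ^ fst p * snd q ^ snd p))"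
    by (rule norm_infsum_bound[OF 1])
  also have "\<dots> \<le> sqrt (\<Sum>\<^sub>\<infinity>p. (cmod (u p))\<^sup>2) * sqrt (kernel_diagonal s t q)"
    using l2_Cauchy_Schwarz(2)[OF u has_sum_imp_summable[OF ev]] by (simp only: eq infsumI[OF ev])
  finally show "cmod (\<Sum>\<^sub>\<infinity>p. a p * fst q ^ fst p * snd q ^ snd p)
      \<le> sqrt (\<Sum>\<^sub>\<infinity>p. (cmod (a p))\<^sup>2 * bidisc_weight s t p) * sqrt (kernel_diagonal s t q)"
    by (simp only: u_sq)
qed

section \<open>Necessity of the growth condition\<close>

text \<open>Without a bound there are points \<open>q\<^sub>n\<close> at which \<open>|h|\<close> exceeds \<open>4\<^sup>n\<close> times the asserted growth. The
  vector that is large against all evaluations at \<open>q\<^sub>n\<close> gives a function \<open>f\<close> in the domain space with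
  \<open>|f(q\<^sub>n)| \<ge> 3\<^sup>-\<^sup>n/2\<close> times the norm of that evaluation. Since \<open>h f\<close> lies in the target space,
  \<open>|h(q\<^sub>n) f(q\<^sub>n)|\<close> is at most a constant times the norm of the evaluation there. The quotient of the
  two norms is a constant times the growth, and \<open>(4/3)\<^sup>n\<close> would be bounded.\<close>

lemma multiplier_imp_growth_bound:
  assumes s: "0 < s" "0 < s'" and t: "0 < t" "0 < t'"
    and h: "h \<in> multipliers (D_space (-s, -t)) (D_space (-s', -t'))"
  shows "\<exists>C. \<forall>(z, w)\<in>bidisc. cmod (h (z, w)) \<le>
    C * (1 - (cmod z)\<^sup>2) powr ((s - s') / 2) * (1 - (cmod w)\<^sup>2) powr ((t - t') / 2)"
proof (rule ccontr)
  define G where "G q = (1 - (cmod (fst q))\<^sup>2) powr ((s - s') / 2) * (1 - (cmod (snd q))\<^sup>2) powr ((t - t') / 2)"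
    for q :: "complex \<times> complex"
  assume neg: "\<not> ?thesis"
  have "\<exists>q\<in>bidisc. C * G q < cmod (h q)" for C
  proof (rule ccontr)
    assume "\<not> (\<exists>q\<in>bidisc. C * G q < cmod (h q))"
    then have "\<forall>(z, w)\<in>bidisc. cmod (h (z, w)) \<le>
      C * (1 - (cmod z)\<^sup>2) powr ((s - s') / 2) * (1 - (cmod w)\<^sup>2) powr ((t - t') / 2)"
      by (auto simp: G_def not_less mult.assoc)
    with neg show False by blast
  qed
  then have "\<exists>q. \<forall>n. q n \<in> bidisc \<and> 4 ^ n * G (q n) < cmod (h (q n))" by (intro choice) blast
  then obtain q where q: "\<And>n. q n \<in> bidisc" and large: "\<And>n :: nat. 4 ^ n * G (q n) < cmod (h (q n))"
    by blast
  define e where "e n = evaluation_vector s t (q n)" for n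
  have e_sum: "((\<lambda>p. (cmod (e n p))\<^sup>2) has_sum kernel_diagonal s t (q n)) UNIV" for n
    unfolding e_def by (rule evaluation_vector_has_sum[OF s(1) t(1) q])
  obtain b where b: "(\<lambda>p. (cmod (b p))\<^sup>2) summable_on UNIV"
    and b_ge: "\<And>n. (1/3) ^ n / 2 * sqrt (\<Sum>\<^sub>\<infinity>p. (cmod (e n p))\<^sup>2) \<le> cmod (\<Sum>\<^sub>\<infinity>p. b p * e n p)"
    using l2_vector_large_against_sequence[of e, OF has_sum_imp_summable[OF e_sum]] by blast
  define a where "a p = b p / of_real (sqrt (bidisc_weight s t p))" for p
  have W: "0 < bidisc_weight s t p" for p by (rule bidisc_weight_pos[OF s(1) t(1)])
  have a_sq: "(cmod (a p))\<^sup>2 * bidisc_weight s t p = (cmod (b p))\<^sup>2" for p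
    using W[of p] by (simp add: a_def norm_divide power_divide)
  have a: "(\<lambda>p. (cmod (a p))\<^sup>2 * bidisc_weight s t p) summable_on UNIV" unfolding a_sq by (rule b)
  define f where "f v = (\<Sum>\<^sub>\<infinity>p. a p * fst v ^ fst p * snd v ^ snd p)" for v
  have "f \<in> D_space (-s, -t)"
  proof -
    have "((\<lambda>(k, l). a (k, l) * z ^ k * w ^ l) has_sum f (z, w)) UNIV" if "(z, w) \<in> bidisc" for z w
      using has_sum_infsum[OF abs_summable_summable[OF point_evaluation(1)[OF s(1) t(1) that a]]]
      by (simp add: f_def case_prod_unfold)
    then show ?thesis unfolding mem_D_space_iff[OF s(1) t(1)] using a by blast
  qed
  then have "(\<lambda>v. h v * f v) \<in> D_space (-s', -t')" using h by (simp add: multipliers_def)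
  then obtain c where c: "(\<lambda>p. (cmod (c p))\<^sup>2 * bidisc_weight s' t' p) summable_on UNIV"
    and c_sum: "\<And>z w. (z, w) \<in> bidisc \<Longrightarrow> ((\<lambda>(k, l). c (k, l) * z ^ k * w ^ l) has_sum h (z, w) * f (z, w)) UNIV"
    unfolding mem_D_space_iff[OF s(2) t(2)] by blast
  define M where "M = sqrt (\<Sum>\<^sub>\<infinity>p. (cmod (c p))\<^sup>2 * bidisc_weight s' t' p)"
  have growth: "(4/3) ^ n * (sqrt s * sqrt t) \<le> 2 * M * (sqrt s' * sqrt t')" for n
  proof -
    define X Y where "X = 1 - (cmod (fst (q n)))\<^sup>2" and "Y = 1 - (cmod (snd (q n)))\<^sup>2"
    have XY: "0 < X" "0 < Y"
      using q[of n] by (auto simp: X_def Y_def bidisc_def abs_square_less_1)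
    have K: "sqrt (kernel_diagonal u v (q n)) = sqrt u * sqrt v * (X powr ((-u - 1) / 2) * Y powr ((-v - 1) / 2))"
      for u v
      using XY by (simp add: kernel_diagonal_def X_def[symmetric] Y_def[symmetric] real_sqrt_mult
          powr_half_sqrt[symmetric] powr_powr)
    have hf: "cmod (h (q n) * f (q n)) \<le> M * sqrt (kernel_diagonal s' t' (q n))"
    proof -
      have "h (q n) * f (q n) = (\<Sum>\<^sub>\<infinity>p. c p * fst (q n) ^ fst p * snd (q n) ^ snd p)"
        using infsumI[OF c_sum[of "fst (q n)" "snd (q n)"]] q[of n] by (simp add: case_prod_unfold)
      then show ?thesis unfolding M_def using point_evaluation(2)[OF s(2) t(2) q c] by simp
    qed
    have "b p * e n p = a p * fst (q n) ^ fst p * snd (q n) ^ snd p" for p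
      using W[of p] by (simp add: a_def e_def evaluation_vector_def)
    then have "f (q n) = (\<Sum>\<^sub>\<infinity>p. b p * e n p)" by (simp add: f_def)
    then have f_ge: "(1/3) ^ n / 2 * sqrt (kernel_diagonal s t (q n)) \<le> cmod (f (q n))"
      using b_ge[of n] by (simp add: infsumI[OF e_sum])
    have "4 ^ n * G (q n) * ((1/3) ^ n / 2 * sqrt (kernel_diagonal s t (q n))) \<le> cmod (h (q n)) * cmod (f (q n))"
      using large[of n] f_ge XY s t
      by (intro mult_mono) (auto simp: K intro: less_imp_le)
    also have "\<dots> \<le> M * sqrt (kernel_diagonal s' t' (q n))" using hf by (simp add: norm_mult)
    finally have le: "4 ^ n * G (q n) * ((1/3) ^ n / 2 * sqrt (kernel_diagonal s t (q n)))
      \<le> M * sqrt (kernel_diagonal s' t' (q n))" .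
    have eq: "4 ^ n * G (q n) * ((1/3) ^ n / 2 * sqrt (kernel_diagonal s t (q n)))
      = ((4/3) ^ n / 2 * (sqrt s * sqrt t)) * (X powr ((-s' - 1) / 2) * Y powr ((-t' - 1) / 2))"
    proof -
      have g: "G (q n) = X powr ((s - s') / 2) * Y powr ((t - t') / 2)" by (simp add: G_def X_def Y_def)
      have x: "X powr ((s - s') / 2) * X powr ((-s - 1) / 2) = X powr ((-s' - 1) / 2)"
        by (simp add: powr_add[symmetric] field_simps)
      have y: "Y powr ((t - t') / 2) * Y powr ((-t - 1) / 2) = Y powr ((-t' - 1) / 2)"
        by (simp add: powr_add[symmetric] field_simps)
      have p: "4 ^ n * (1/3) ^ n = (4/3 :: real) ^ n" by (simp add: power_mult_distrib[symmetric])
      show ?thesis unfolding g K x[symmetric] y[symmetric] p[symmetric] by simp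
    qed
    have "((4/3) ^ n / 2 * (sqrt s * sqrt t)) * (X powr ((-s' - 1) / 2) * Y powr ((-t' - 1) / 2))
        \<le> (M * (sqrt s' * sqrt t')) * (X powr ((-s' - 1) / 2) * Y powr ((-t' - 1) / 2))"
      using le unfolding eq unfolding K by (simp only: mult.assoc)
    moreover have "0 < X powr ((-s' - 1) / 2) * Y powr ((-t' - 1) / 2)" using XY by simp
    ultimately have "(4/3) ^ n / 2 * (sqrt s * sqrt t) \<le> M * (sqrt s' * sqrt t')"
      by (simp only: mult_le_cancel_right_pos)
    then show ?thesis by simp
  qed
  have pos: "0 < sqrt s * sqrt t" using s t by simp
  obtain n where "2 * M * (sqrt s' * sqrt t') / (sqrt s * sqrt t) < (4/3) ^ n"
    using real_arch_pow[of "4/3"] by auto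
  then have "2 * M * (sqrt s' * sqrt t') < (4/3) ^ n * (sqrt s * sqrt t)"
    using pos by (simp only: pos_divide_less_eq)
  with growth[of n] show False by simp
qed

section \<open>Regularity of double power series and of holomorphic functions\<close>

text \<open>The double series is enumerated by the pairing function, because the test for uniform
  convergence concerns series indexed by natural numbers.\<close>

lemma double_power_series_uniform_limit:
  fixes a :: "nat \<times> nat \<Rightarrow> complex"
  assumes f: "\<And>z w. (z, w) \<in> bidisc \<Longrightarrow> ((\<lambda>(k, l). a (k, l) * z ^ k * w ^ l) has_sum f (z, w)) UNIV"
    and abs: "\<And>z w. (z, w) \<in> bidisc \<Longrightarrow> (\<lambda>p. cmod (a p * z ^ fst p * w ^ snd p)) summable_on UNIV"
    and r: "0 \<le> r" "r < 1"
  shows "uniform_limit (cball 0 r \<times> cball 0 r)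
    (\<lambda>n v. \<Sum>i<n. a (prod_decode i) * fst v ^ fst (prod_decode i) * snd v ^ snd (prod_decode i)) f sequentially"
proof -
  let ?e = "prod_decode" and ?A = "cball 0 r \<times> cball 0 r :: (complex \<times> complex) set"
  let ?t = "\<lambda>i v. a (?e i) * fst v ^ fst (?e i) * snd v ^ snd (?e i)"
  define M where "M p = cmod (a p * of_real r ^ fst p * of_real r ^ snd p)" for p
  have "M summable_on UNIV"
    unfolding M_def by (rule abs) (use r in \<open>simp add: bidisc_def\<close>)
  then have "(\<lambda>i. M (?e i)) summable_on UNIV"
    by (simp add: summable_on_reindex_bij_betw[OF bij_prod_decode])
  then have "summable (\<lambda>i. M (?e i))" by (rule summable_on_imp_summable)
  moreover have "norm (?t i v) \<le> M (?e i)" if "v \<in> ?A" for i v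
    using that r by (auto simp: M_def norm_mult norm_power intro!: mult_mono power_mono)
  ultimately have "uniform_limit ?A (\<lambda>n v. \<Sum>i<n. ?t i v) (\<lambda>v. \<Sum>i. ?t i v) sequentially"
    by (intro Weierstrass_m_test) auto
  moreover have "(\<Sum>i. ?t i v) = f v" if "v \<in> ?A" for v
  proof -
    have "(fst v, snd v) \<in> bidisc" using that r by (auto simp: bidisc_def)
    from f[OF this] have "((\<lambda>p. a p * fst v ^ fst p * snd v ^ snd p) has_sum f v) UNIV"
      by (simp add: case_prod_unfold)
    then have "((\<lambda>i. ?t i v) has_sum f v) UNIV"
      by (simp add: has_sum_reindex_bij_betw[OF bij_prod_decode, of "\<lambda>p. a p * fst v ^ fst p * snd v ^ snd p"])
    then show ?thesis by (rule sums_unique[OF has_sum_imp_sums, symmetric])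
  qed
  ultimately show ?thesis by (simp cong: uniform_limit_cong')
qed

text \<open>All three properties pass from the polynomial partial sums to the limit, since the convergence
  is uniform on compact subsets of the bidisc.\<close>

lemma double_power_series_regular:
  fixes a :: "nat \<times> nat \<Rightarrow> complex"
  assumes f: "\<And>z w. (z, w) \<in> bidisc \<Longrightarrow> ((\<lambda>(k, l). a (k, l) * z ^ k * w ^ l) has_sum f (z, w)) UNIV"
    and abs: "\<And>z w. (z, w) \<in> bidisc \<Longrightarrow> (\<lambda>p. cmod (a p * z ^ fst p * w ^ snd p)) summable_on UNIV"
  shows "continuous_on bidisc f"
    and "\<And>w. w \<in> ball 0 1 \<Longrightarrow> (\<lambda>z. f (z, w)) holomorphic_on ball 0 1"
    and "\<And>z. z \<in> ball 0 1 \<Longrightarrow> (\<lambda>w. f (z, w)) holomorphic_on ball 0 1"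
proof -
  define P where "P n v = (\<Sum>i<n. a (prod_decode i) * fst v ^ fst (prod_decode i) * snd v ^ snd (prod_decode i))"
    for n :: nat and v :: "complex \<times> complex"
  have lim: "uniform_limit (cball 0 r \<times> cball 0 r) P f sequentially" if "0 \<le> r" "r < 1" for r
    unfolding P_def[abs_def] by (rule double_power_series_uniform_limit[OF f abs that])
  have between: "\<exists>r. 0 < r \<and> r < 1 \<and> cmod z < r \<and> cmod w < r" if "z \<in> ball 0 1" "w \<in> ball 0 1" for z w :: complex
  proof -
    have "max (cmod z) (cmod w) < 1" using that by simp
    then obtain r where "max (cmod z) (cmod w) < r" "r < 1" using dense by blast
    moreover from this have "0 < r" using norm_ge_zero[of z] by linarith
    ultimately show ?thesis by (intro exI[of _ r]) auto
  qed
  show "continuous_on bidisc f"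
  proof (rule continuous_at_imp_continuous_on, rule ballI)
    fix v assume "v \<in> bidisc"
    then obtain r where r: "0 < r" "r < 1" "cmod (fst v) < r" "cmod (snd v) < r"
      using between[of "fst v" "snd v"] by (auto simp: bidisc_def)
    have "continuous_on (cball 0 r \<times> cball 0 r) f"
    proof (rule uniform_limit_theorem[OF _ lim])
      show "\<forall>\<^sub>F n in sequentially. continuous_on (cball 0 r \<times> cball 0 r) (P n)"
        unfolding P_def by (intro always_eventually allI continuous_intros)
    qed (use r in auto)
    then have "continuous_on (ball 0 r \<times> ball 0 r) f"
      by (rule continuous_on_subset) auto
    then have "\<forall>x\<in>ball 0 r \<times> ball 0 r. isCont f x"
      by (subst (asm) continuous_on_eq_continuous_at) (auto simp: open_Times)
    then show "isCont f v"
      by (rule bspec) (use r in \<open>simp add: mem_Times_iff\<close>)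
  qed
  have cball_inside: "\<exists>d r. 0 < d \<and> 0 \<le> r \<and> r < 1 \<and> cmod w \<le> r \<and> cball z d \<subseteq> cball 0 r"
    if zw: "z \<in> ball 0 1" "w \<in> ball 0 1" for z w :: complex
  proof -
    obtain r where r: "0 < r" "r < 1" "cmod z < r" "cmod w < r" using between[OF zw] by blast
    have "cball z (r - cmod z) \<subseteq> cball 0 r"
    proof
      fix x assume "x \<in> cball z (r - cmod z)"
      then show "x \<in> cball 0 r" using norm_triangle_sub[of x z] by (simp add: dist_norm norm_minus_commute)
    qed
    then show ?thesis using r by (intro exI[of _ "r - cmod z"] exI[of _ r]) auto
  qed
  show "(\<lambda>z. f (z, w)) holomorphic_on ball 0 1" if w: "w \<in> ball 0 1" for w
  proof (rule holomorphic_uniform_sequence)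
    show "(\<lambda>z. P n (z, w)) holomorphic_on ball 0 1" for n
      unfolding P_def fst_conv snd_conv by (intro holomorphic_intros)
    fix z :: complex assume "z \<in> ball 0 1"
    then obtain d r where dr: "0 < d" "0 \<le> r" "r < 1" "cmod w \<le> r" "cball z d \<subseteq> cball 0 r"
      using cball_inside w by blast
    have "uniform_limit (cball z d) (\<lambda>n z. P n (z, w)) (\<lambda>z. f (z, w)) sequentially"
      by (rule uniform_limit_compose'[OF lim[OF dr(2,3)]]) (use dr in auto)
    moreover have "cball z d \<subseteq> ball 0 1" using dr by fastforce
    ultimately show "\<exists>d. 0 < d \<and> cball z d \<subseteq> ball 0 1 \<and>
        uniform_limit (cball z d) (\<lambda>n z. P n (z, w)) (\<lambda>z. f (z, w)) sequentially"
      using dr(1) by blast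
  qed simp
  show "(\<lambda>w. f (z, w)) holomorphic_on ball 0 1" if z: "z \<in> ball 0 1" for z
  proof (rule holomorphic_uniform_sequence)
    show "(\<lambda>w. P n (z, w)) holomorphic_on ball 0 1" for n
      unfolding P_def fst_conv snd_conv by (intro holomorphic_intros)
    fix w :: complex assume "w \<in> ball 0 1"
    then obtain d r where dr: "0 < d" "0 \<le> r" "r < 1" "cmod z \<le> r" "cball w d \<subseteq> cball 0 r"
      using cball_inside z by blast
    have "uniform_limit (cball w d) (\<lambda>n w. P n (z, w)) (\<lambda>w. f (z, w)) sequentially"
      by (rule uniform_limit_compose'[OF lim[OF dr(2,3)]]) (use dr in auto)
    moreover have "cball w d \<subseteq> ball 0 1" using dr by fastforce
    ultimately show "\<exists>d. 0 < d \<and> cball w d \<subseteq> ball 0 1 \<and>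
        uniform_limit (cball w d) (\<lambda>n w. P n (z, w)) (\<lambda>w. f (z, w)) sequentially"
      using dr(1) by blast
  qed simp
qed

lemma holomorphic2_on_bidiscD:
  assumes h: "h holomorphic2_on bidisc"
  shows "continuous_on bidisc h"
    and "\<And>w. w \<in> ball 0 1 \<Longrightarrow> (\<lambda>z. h (z, w)) holomorphic_on ball 0 1"
    and "\<And>z. z \<in> ball 0 1 \<Longrightarrow> (\<lambda>w. h (z, w)) holomorphic_on ball 0 1"
proof -
  have op: "open bidisc" by (simp add: bidisc_def open_Times)
  have deriv: "\<exists>a b. (h has_derivative (\<lambda>(u, v). a * u + b * v)) (at p)" if "p \<in> bidisc" for p
  proof -
    have "\<exists>a b. (h has_derivative (\<lambda>(u, v). a * u + b * v)) (at p within bidisc)"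
      using h[unfolded holomorphic2_on_def] that by (rule bspec)
    then show ?thesis by (simp only: at_within_open[OF that op])
  qed
  show "continuous_on bidisc h"
  proof (rule continuous_at_imp_continuous_on, rule ballI)
    fix p assume "p \<in> bidisc"
    then obtain a b where "(h has_derivative (\<lambda>(u, v). a * u + b * v)) (at p)" using deriv by blast
    then show "isCont h p" by (rule has_derivative_continuous)
  qed
  show "(\<lambda>z. h (z, w)) holomorphic_on ball 0 1" if w: "w \<in> ball 0 1" for w
  proof (rule holomorphic_onI)
    fix z :: complex assume "z \<in> ball 0 1"
    then obtain a b where d: "(h has_derivative (\<lambda>(u, v). a * u + b * v)) (at (z, w))"
      using deriv[of "(z, w)"] w by (auto simp: bidisc_def)
    have "((\<lambda>z. (z, w)) has_derivative (\<lambda>u. (u, 0))) (at z within ball 0 1)"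
      by (intro derivative_intros)
    from has_derivative_compose[OF this d]
    have "((\<lambda>z. h (z, w)) has_field_derivative a) (at z within ball 0 1)"
      by (simp add: has_field_derivative_def)
    then show "(\<lambda>z. h (z, w)) field_differentiable at z within ball 0 1"
      by (auto simp: field_differentiable_def)
  qed
  show "(\<lambda>w. h (z, w)) holomorphic_on ball 0 1" if z: "z \<in> ball 0 1" for z
  proof (rule holomorphic_onI)
    fix w :: complex assume "w \<in> ball 0 1"
    then obtain a b where d: "(h has_derivative (\<lambda>(u, v). a * u + b * v)) (at (z, w))"
      using deriv[of "(z, w)"] z by (auto simp: bidisc_def)
    have "((\<lambda>w. (z, w)) has_derivative (\<lambda>u. (0, u))) (at w within ball 0 1)"
      by (intro derivative_intros)
    from has_derivative_compose[OF this d]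
    have "((\<lambda>w. h (z, w)) has_field_derivative b) (at w within ball 0 1)"
      by (simp add: has_field_derivative_def)
    then show "(\<lambda>w. h (z, w)) field_differentiable at w within ball 0 1"
      by (auto simp: field_differentiable_def)
  qed
qed

section \<open>Sufficiency of the growth condition\<close>

text \<open>Parseval's formula on the torus \<open>|z|\<^sup>2 = x\<close>, \<open>|w|\<^sup>2 = y\<close>. The radii are square roots so that the
  moduli of the monomials, once squared, are the monomials in \<open>x\<close> and \<open>y\<close> that the weights integrate.\<close>

lemma circle_means_tendsto:
  fixes a :: "nat \<times> nat \<Rightarrow> complex"
  assumes f: "\<And>z w. (z, w) \<in> bidisc \<Longrightarrow> ((\<lambda>(k, l). a (k, l) * z ^ k * w ^ l) has_sum f (z, w)) UNIV"
    and x: "0 \<le> x" "x < 1" and y: "0 \<le> y" "y < 1"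
  shows "(\<lambda>(k, l). (cmod (a (k, l)))\<^sup>2 * x ^ k * y ^ l) summable_on UNIV"
    and "(\<lambda>N. (\<Sum>i<N. \<Sum>j<N. (cmod (f (of_real (sqrt x) * unity_root N i, of_real (sqrt y) * unity_root N j)))\<^sup>2) / (real N)\<^sup>2)
      \<longlonglongrightarrow> (\<Sum>\<^sub>\<infinity>(k, l). (cmod (a (k, l)))\<^sup>2 * x ^ k * y ^ l)"
proof -
  define d where "d p = a p * of_real (sqrt x) ^ fst p * of_real (sqrt y) ^ snd p" for p
  have sq: "(cmod (d p))\<^sup>2 = (case p of (k, l) \<Rightarrow> (cmod (a (k, l)))\<^sup>2 * x ^ k * y ^ l)" for p
    using x y by (simp add: d_def case_prod_unfold norm_mult norm_power power_mult_distrib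
        power_even_abs power2_abs power_mult[symmetric] mult.commute[of _ 2])
       (simp add: power_mult)
  have "(of_real (sqrt x), of_real (sqrt y)) \<in> bidisc" using x y by (simp add: bidisc_def)
  from has_sum_imp_summable[OF f[OF this]]
  have "d summable_on UNIV" by (simp add: d_def[abs_def] case_prod_unfold)
  then have d: "(\<lambda>p. cmod (d p)) summable_on UNIV"
    by (simp add: summable_on_iff_abs_summable_on_complex)
  show "(\<lambda>(k, l). (cmod (a (k, l)))\<^sup>2 * x ^ k * y ^ l) summable_on UNIV"
    using summable_on_norm_square[OF d] by (simp only: sq)
  have "(\<Sum>\<^sub>\<infinity>(k, l). d (k, l) * unity_root N i ^ k * unity_root N j ^ l)
      = f (of_real (sqrt x) * unity_root N i, of_real (sqrt y) * unity_root N j)" for N i j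
  proof -
    have "(of_real (sqrt x) * unity_root N i, of_real (sqrt y) * unity_root N j) \<in> bidisc"
      using x y by (simp add: bidisc_def norm_mult)
    from infsumI[OF f[OF this]] show ?thesis
      by (simp add: d_def power_mult_distrib mult_ac)
  qed
  with torus_Parseval[OF d] show "(\<lambda>N. (\<Sum>i<N. \<Sum>j<N. (cmod (f (of_real (sqrt x) * unity_root N i, of_real (sqrt y) * unity_root N j)))\<^sup>2) / (real N)\<^sup>2)
      \<longlonglongrightarrow> (\<Sum>\<^sub>\<infinity>(k, l). (cmod (a (k, l)))\<^sup>2 * x ^ k * y ^ l)"
    by (simp only: sq)
qed

text \<open>On the torus \<open>|z|\<^sup>2 = x\<close>, \<open>|w|\<^sup>2 = y\<close> the growth bound for \<open>h\<close> is a constant. Hence the mean of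
  \<open>|h f|\<^sup>2\<close> there is at most the square of this constant times the mean of \<open>|f|\<^sup>2\<close>, and Parseval's
  formula turns this into the inequality between power series in \<open>x\<close> and \<open>y\<close> that is integrated
  against the Beta densities.\<close>

lemma growth_bound_imp_multiplier:
  assumes s: "0 < s" "0 < s'" and t: "0 < t" "0 < t'"
    and h: "h holomorphic2_on bidisc"
    and bound: "\<And>z w. (z, w) \<in> bidisc \<Longrightarrow> cmod (h (z, w)) \<le>
      C * (1 - (cmod z)\<^sup>2) powr ((s - s') / 2) * (1 - (cmod w)\<^sup>2) powr ((t - t') / 2)"
  shows "h \<in> multipliers (D_space (-s, -t)) (D_space (-s', -t'))"
  unfolding multipliers_def
proof (rule CollectI, rule ballI)
  fix f assume "f \<in> D_space (-s, -t)"
  then obtain a where a: "(\<lambda>p. (cmod (a p))\<^sup>2 * bidisc_weight s t p) summable_on UNIV"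
    and f: "\<And>z w. (z, w) \<in> bidisc \<Longrightarrow> ((\<lambda>(k, l). a (k, l) * z ^ k * w ^ l) has_sum f (z, w)) UNIV"
    unfolding mem_D_space_iff[OF s(1) t(1)] by blast
  have a_abs: "(\<lambda>p. cmod (a p * z ^ fst p * w ^ snd p)) summable_on UNIV" if "(z, w) \<in> bidisc" for z w
    using point_evaluation(1)[OF s(1) t(1) that a] by simp
  have f_cont: "continuous_on bidisc f"
    by (rule double_power_series_regular(1)[of a]) (fact f a_abs)+
  have f_z: "(\<lambda>z. f (z, w)) holomorphic_on ball 0 1" if "w \<in> ball 0 1" for w
    by (rule double_power_series_regular(2)[of a]) (fact f a_abs that)+
  have f_w: "(\<lambda>w. f (z, w)) holomorphic_on ball 0 1" if "z \<in> ball 0 1" for z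
    by (rule double_power_series_regular(3)[of a]) (fact f a_abs that)+
  note h_reg = holomorphic2_on_bidiscD[OF h]
  let ?g = "\<lambda>p. h p * f p"
  have cont: "continuous_on (ball 0 1 \<times> ball 0 1) ?g"
    using continuous_on_mult[OF h_reg(1) f_cont] by (simp add: bidisc_def)
  have hz: "(\<lambda>z. ?g (z, w)) holomorphic_on ball 0 1" if "w \<in> ball 0 1" for w
    by (rule holomorphic_on_mult[OF h_reg(2)[OF that] f_z[OF that]])
  have hw: "(\<lambda>w. ?g (z, w)) holomorphic_on ball 0 1" if "z \<in> ball 0 1" for z
    by (rule holomorphic_on_mult[OF h_reg(3)[OF that] f_w[OF that]])
  obtain c where c: "\<And>z w. z \<in> ball 0 1 \<Longrightarrow> w \<in> ball 0 1 \<Longrightarrow>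
      ((\<lambda>(k, l). c (k, l) * z ^ k * w ^ l) has_sum ?g (z, w)) UNIV"
    using separately_holomorphic_power_series[OF cont hz hw] by blast
  have g: "((\<lambda>(k, l). c (k, l) * z ^ k * w ^ l) has_sum ?g (z, w)) UNIV" if "(z, w) \<in> bidisc" for z w
    using c that by (simp add: bidisc_def)
  have "(\<lambda>(k, l). (cmod (c (k, l)))\<^sup>2 * (beta_weight s' k * beta_weight t' l)) summable_on UNIV"
  proof (rule summable_on_beta_weights_if_radial_bound[OF s t, where A="\<lambda>p. (cmod (a p))\<^sup>2" and D="C\<^sup>2"])
    show "(\<lambda>(k, l). (cmod (a (k, l)))\<^sup>2 * (beta_weight s k * beta_weight t l)) summable_on UNIV"
      using a by (simp add: bidisc_weight_def case_prod_unfold)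
  next
    fix x y :: real assume x: "0 \<le> x" "x < 1" and y: "0 \<le> y" "y < 1"
    show "(\<lambda>(k, l). (cmod (a (k, l)))\<^sup>2 * x ^ k * y ^ l) summable_on UNIV"
      by (rule circle_means_tendsto(1)[OF f x y])
    show "(\<lambda>(k, l). (cmod (c (k, l)))\<^sup>2 * x ^ k * y ^ l) summable_on UNIV"
      by (rule circle_means_tendsto(1)[OF g x y])
    let ?B = "C\<^sup>2 * (1 - x) powr (s - s') * (1 - y) powr (t - t')"
    let ?v = "\<lambda>N i j. (of_real (sqrt x) * unity_root N i, of_real (sqrt y) * unity_root N j)"
    have pt: "(cmod (?g (?v N i j)))\<^sup>2 \<le> ?B * (cmod (f (?v N i j)))\<^sup>2" for N i j
    proof -
      have "?v N i j \<in> bidisc" using x y by (simp add: bidisc_def norm_mult)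
      from bound[OF this]
      have "cmod (h (?v N i j)) \<le> C * (1 - x) powr ((s - s') / 2) * (1 - y) powr ((t - t') / 2)"
        using x y by (simp add: norm_mult)
      then have "(cmod (h (?v N i j)))\<^sup>2 \<le> (C * (1 - x) powr ((s - s') / 2) * (1 - y) powr ((t - t') / 2))\<^sup>2"
        by (rule power_mono) simp
      also have "\<dots> = ?B"
        by (simp add: power_mult_distrib power2_eq_square[of "_ powr _"] powr_add[symmetric])
      finally show ?thesis by (simp add: norm_mult power_mult_distrib mult_right_mono)
    qed
    have le: "(\<Sum>i<N. \<Sum>j<N. (cmod (?g (?v N i j)))\<^sup>2) / (real N)\<^sup>2
        \<le> ?B * ((\<Sum>i<N. \<Sum>j<N. (cmod (f (?v N i j)))\<^sup>2) / (real N)\<^sup>2)" for N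
    proof -
      have "(\<Sum>i<N. \<Sum>j<N. (cmod (?g (?v N i j)))\<^sup>2) \<le> ?B * (\<Sum>i<N. \<Sum>j<N. (cmod (f (?v N i j)))\<^sup>2)"
        unfolding sum_distrib_left by (intro sum_mono pt)
      from divide_right_mono[OF this, of "(real N)\<^sup>2"] show ?thesis by simp
    qed
    show "(\<Sum>\<^sub>\<infinity>(k, l). (cmod (c (k, l)))\<^sup>2 * x ^ k * y ^ l)
        \<le> ?B * (\<Sum>\<^sub>\<infinity>(k, l). (cmod (a (k, l)))\<^sup>2 * x ^ k * y ^ l)"
    proof (rule LIMSEQ_le)
      show "(\<lambda>N. (\<Sum>i<N. \<Sum>j<N. (cmod (?g (?v N i j)))\<^sup>2) / (real N)\<^sup>2)
          \<longlonglongrightarrow> (\<Sum>\<^sub>\<infinity>(k, l). (cmod (c (k, l)))\<^sup>2 * x ^ k * y ^ l)"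
        by (rule circle_means_tendsto(2)[OF g x y])
      show "(\<lambda>N. ?B * ((\<Sum>i<N. \<Sum>j<N. (cmod (f (?v N i j)))\<^sup>2) / (real N)\<^sup>2))
          \<longlonglongrightarrow> ?B * (\<Sum>\<^sub>\<infinity>(k, l). (cmod (a (k, l)))\<^sup>2 * x ^ k * y ^ l)"
        by (rule tendsto_mult_left[OF circle_means_tendsto(2)[OF f x y]])
      show "\<exists>N0. \<forall>N\<ge>N0. (\<Sum>i<N. \<Sum>j<N. (cmod (?g (?v N i j)))\<^sup>2) / (real N)\<^sup>2
          \<le> ?B * ((\<Sum>i<N. \<Sum>j<N. (cmod (f (?v N i j)))\<^sup>2) / (real N)\<^sup>2)"
        by (intro exI[of _ 0] allI impI le)
    qed
  qed auto
  then have "(\<lambda>p. (cmod (c p))\<^sup>2 * bidisc_weight s' t' p) summable_on UNIV"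
    by (simp add: bidisc_weight_def case_prod_unfold)
  then show "?g \<in> D_space (-s', -t')"
    unfolding mem_D_space_iff[OF s(2) t(2)] using g by blast
qed

theorem theorem3p8:
  fixes \<alpha> \<beta> :: "real \<times> real" and h :: "complex \<times> complex \<Rightarrow> complex"
  assumes "(0, 0) \<succ> \<alpha>" and "\<alpha> \<succeq> \<beta>"
    and "h holomorphic2_on bidisc"
  shows "h \<in> multipliers (D_space \<alpha>) (D_space \<beta>) \<longleftrightarrow>
    (\<exists>C :: real. \<forall>(z, w)\<in>bidisc.
       cmod (h (z, w)) \<le> C * (1 - (cmod z)\<^sup>2) powr ((fst \<beta> - fst \<alpha>) / 2)
                           * (1 - (cmod w)\<^sup>2) powr ((snd \<beta> - snd \<alpha>) / 2))"
proof -
  define s t s' t' where "s = - fst \<alpha>" and "t = - snd \<alpha>" and "s' = - fst \<beta>" and "t' = - snd \<beta>"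
  have pos: "0 < s" "0 < s'" "0 < t" "0 < t'"
    using assms(1,2) by (auto simp: s_def t_def s'_def t'_def pair_succ_def pair_succeq_def)
  have ab: "\<alpha> = (-s, -t)" "\<beta> = (-s', -t')" by (simp_all add: s_def t_def s'_def t'_def)
  have ex: "fst \<beta> - fst \<alpha> = s - s'" "snd \<beta> - snd \<alpha> = t - t'"
    by (simp_all add: s_def t_def s'_def t'_def)
  show ?thesis
    unfolding ex unfolding ab
    using multiplier_imp_growth_bound[OF pos] growth_bound_imp_multiplier[OF pos assms(3)] by blast
qed

end
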